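(* Let $\Phi=(A;\{E_i\}_{i=0}^d;A^*;\{E^*_i\}_{i=0}^d)$ be a Leonard system in $\mathcal{A}$ with parameter array $(\{\theta_i\}_{i=0}^d;\{\theta^*_i\}_{i=0}^d;\{\varphi_i\}_{i=1}^d;\{\phi_i\}_{i=1}^d)$, and let $\xi_0\in E_0V$, $\xi_d\in E_dV$, $\xi^*_0\in E^*_0V$, $\xi^*_d\in E^*_dV$ be nonzero vectors. Then (i) and (ii) hold. (i) Let $\{X_i\}_{i=0}^d$ denote one of the sequences $\{E_i\}_{i=0}^d$, $\{E_{d-i}\}_{i=0}^d$, $\{\tau_i(A)\}_{i=0}^d$, $\{\tau_{d-i}(A)\}_{i=0}^d$, $\{\eta_i(A)\}_{i=0}^d$, $\{\eta_{d-i}(A)\}_{i=0}^d$. Then for $0\le i\le d$, \begin{align*} \frac{\eta^*_d(\theta^*_0)}{\varphi}\frac{\langle\xi_d,\xi^*_0\rangle}{\langle\xi_d,\xi^*_d\rangle}\sum_{r=0}^dX_rE^*_0\tau_{d-r}(A)\cdot\eta_i(A)\xi^*_d &= X_i\xi^*_0,\\ \frac{1}{\mathrm{tr}(E_dE^*_d)}\sum_{r=0}^d\frac{X_rE^*_dE_d\eta^*_r(A^* )}{\varphi_d\varphi_{d-1}\cdots\varphi_{d-r+1}}\cdot\eta_i(A)\xi^*_d &= X_i\xi^*_d,\\ \frac{\eta^*_d(\theta^*_0)}{\varphi}\frac{\langle\xi_d,\xi^*_0\rangle}{\langle\xi_d,\xi^*_d\rangle}\sum_{r=0}^dX_{d-r}E^*_0\tau_{d-r}(A)\cdot\eta_{d-i}(A)\xi^*_d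 &= X_i\xi^*_0,\\ \frac{1}{\mathrm{tr}(E_dE^*_d)}\sum_{r=0}^d\frac{X_{d-r}E^*_dE_d\eta^*_r(A^* )}{\varphi_d\varphi_{d-1}\cdots\varphi_{d-r+1}}\cdot\eta_{d-i}(A)\xi^*_d &= X_i\xi^*_d. \end{align*} (ii) Let $\{X_i\}_{i=0}^d$ denote one of the sequences $\{E^*_i\}_{i=0}^d$, $\{E^*_{d-i}\}_{i=0}^d$, $\{\tau^*_i(A^* )\}_{i=0}^d$, $\{\tau^*_{d-i}(A^* )\}_{i=0}^d$, $\{\eta^*_i(A^* )\}_{i=0}^d$, $\{\eta^*_{d-i}(A^* )\}_{i=0}^d$. Then for $0\le i\le d$, \begin{align*} \frac{\eta^*_d(\theta^*_0)}{\phi}\frac{\langle\xi_0,\xi_0\rangle}{\langle\xi_0,\xi^*_d\rangle}\sum_{r=0}^dX_rE_0E^*_0\tau_{d-r}(A)\cdot\eta_i(A)\xi^*_d &= X_i\xi_0,\\ \frac{\langle\xi_d,\xi_d\rangle}{\langle\xi_d,\xi^*_d\rangle}\sum_{r=0}^d\frac{X_rE_d\eta^*_r(A^* )}{\varphi_d\varphi_{d-1}\cdots\varphi_{d-r+1}}\cdot\eta_i(A)\xi^*_d &= X_i\xi_d,\\ \frac{\eta^*_d(\theta^*_0)}{\phi}\frac{\langle\xi_0,\xi_0\rangle}{\langle\xi_0,\xi^*_d\rangle}\sum_{r=0}^dX_{d-r}E_0E^*_0\tau_{d-r}(A)\cdot\eta_{d-i}(A)\xi^*_d &= X_i\xi_0,\\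 \frac{\langle\xi_d,\xi_d\rangle}{\langle\xi_d,\xi^*_d\rangle}\sum_{r=0}^d\frac{X_{d-r}E_d\eta^*_r(A^* )}{\varphi_d\varphi_{d-1}\cdots\varphi_{d-r+1}}\cdot\eta_{d-i}(A)\xi^*_d &= X_i\xi_d. \end{align*}
   Context: Let $\mathbb{K}$ be a field, $d\ge 0$ an integer, $\mathcal{A}$ a $\mathbb{K}$-algebra isomorphic to the algebra $\mathrm{Mat}_{d+1}(\mathbb{K})$ of all $(d+1)\times(d+1)$ matrices over $\mathbb{K}$, $I$ its identity, and $V$ an irreducible left $\mathcal{A}$-module (so $\dim V=d+1$). For $X\in\mathcal{A}$, $\mathrm{tr}(X)$ is the trace of $X$ (equivalently of its action on $V$). Leonard system. An element of $\mathcal{A}$ is multiplicity-free if it has $d+1$ mutually distinct eigenvalues in $\mathbb{K}$. If $A$ is multiplicity-free with eigenvalues $\theta_0,\dots,\theta_d$, the primitive idempotent of $A$ associated with $\theta_i$ is $E_i=\prod_{0\le j\le d,\,j\ne i}\frac{A-\theta_jI}{\theta_i-\theta_j}$ (the projection onto the one-dimensional $\theta_i$-eigenspace $E_iV$). A Leonard system in $\mathcal{A}$ is a sequence $\Phi=(A;\{E_i\}_{i=0}^d;A^*;\{E^*_i\}_{i=0}^d)$ such that: (i) each of $A,A^*$ is a multiplicity-free element of $\mathcal{A}$ ($A^*$ is just another element; no adjoint is meant); (ii) $\{E_i\}_{i=0}^d$ is an ordering of the primitive idempotents of $A$; (iii) $\{E^*_i\}_{i=0}^d$ is an ordering of the primitive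 idempotents of $A^*$; (iv) for $0\le i,j\le d$, $E_iA^*E_j=0$ if $|i-j|>1$ and $E_iA^*E_j\ne0$ if $|i-j|=1$; (v) for $0\le i,j\le d$, $E^*_iAE^*_j=0$ if $|i-j|>1$ and $E^*_iAE^*_j\neq0$ if $|i-j|=1$. Parameter array. $\theta_i$ (resp. $\theta^*_i$) is the eigenvalue of $A$ (resp. $A^*$) associated with $E_i$ (resp. $E^*_i$). For $0\le i\le d$ define polynomials $\tau_i=(\lambda-\theta_0)(\lambda-\theta_1)\cdots(\lambda-\theta_{i-1})$, $\eta_i=(\lambda-\theta_d)(\lambda-\theta_{d-1})\cdots(\lambda-\theta_{d-i+1})$, $\tau^*_i=(\lambda-\theta^*_0)(\lambda-\theta^*_1)\cdots(\lambda-\theta^*_{i-1})$, $\eta^*_i=(\lambda-\theta^*_d)(\lambda-\theta^*_{d-1})\cdots(\lambda-\theta^*_{d-i+1})$. For $1\le i\le d$ define $\varphi_i=(\theta^*_0-\theta^*_i)\frac{\mathrm{tr}(\tau_i(A)E^*_0)}{\mathrm{tr}(\tau_{i-1}(A)E^*_0)}$ and $\phi_i=(\theta^*_0-\theta^*_i)\frac{\mathrm{tr}(\eta_i(A)E^*_0)}{\mathrm{tr}(\eta_{i-1}(A)E^*_0)}$; the denominators, and all $\varphi_i,\phi_i$, are known to be nonzero. The parameter array of $\Phi$ is $(\{\theta_i\}_{i=0}^d;\{\theta^*_i\}_{i=0}^d;\{\varphi_i\}_{i=1}^d;\{\phi_i\}_{i=1}^d)$. Abbreviate $\varphi=\varphi_1\varphi_2\cdots\varphi_d$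 and $\phi=\phi_1\phi_2\cdots\phi_d$. Empty products are $1$. Bilinear form. There is a unique antiautomorphism $\dagger$ of $\mathcal{A}$ ($\mathbb{K}$-linear bijection with $(XY)^\dagger=Y^\dagger X^\dagger$) with $A^\dagger=A$ and $A^{*\dagger}=A^*$. $\langle\,,\rangle$ denotes a fixed nonzero bilinear form on $V$ with $\langle Xu,v\rangle=\langle u,X^\dagger v\rangle$ for all $X\in\mathcal{A}$, $u,v\in V$; it exists, is unique up to a nonzero scalar factor, and is nondegenerate and symmetric. All scalars appearing in denominators (traces and inner products) are known to be nonzero. The notation $T\cdot v$ means the element $T\in\mathcal{A}$ (including the scalar prefactor and the whole sum) applied to $v\in V$. *)

theory Defs
  imports "Jordan_Normal_Form.Char_Poly"
begin

text \<open>
  A \<open>K\<close>-algebra is a type of class \<open>ring_1\<close> with a scalar multiplication \<open>sA\<close>.  It is given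
  together with an isomorphism \<open>\<rho>\<close> onto the algebra of all \<open>(d+1) \<times> (d+1)\<close> matrices; eigenvalues
  and traces are read off through \<open>\<rho>\<close> and do not depend on its choice.
\<close>

locale full_matrix_algebra = vector_space sA
  for sA :: "'k::field \<Rightarrow> 'a::ring_1 \<Rightarrow> 'a"
  and d :: nat
  and \<rho> :: "'a \<Rightarrow> 'k mat" +
  assumes sA_mult_left: "sA c X * Y = sA c (X * Y)"
    and sA_mult_right: "X * sA c Y = sA c (X * Y)"
    and iso_bij: "bij_betw \<rho> UNIV (carrier_mat (Suc d) (Suc d))"
    and iso_add: "\<rho> (X + Y) = \<rho> X + \<rho> Y"
    and iso_mult: "\<rho> (X * Y) = \<rho> X * \<rho> Y"
    and iso_one: "\<rho> 1 = 1\<^sub>m (Suc d)"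
    and iso_scale: "\<rho> (sA c X) = c \<cdot>\<^sub>m \<rho> X"

text \<open>
  Irreducible left module of an algebra.  The vector space structure \<open>sV\<close> is the one induced by
  the action of the scalar multiples of the identity, so a submodule is just an additive subgroup
  that is stable under the action.
\<close>

locale irreducible_left_module = vector_space sV
  for sA :: "'k::field \<Rightarrow> 'a::ring_1 \<Rightarrow> 'a"
  and sV :: "'k \<Rightarrow> 'v::ab_group_add \<Rightarrow> 'v"
  and act :: "'a \<Rightarrow> 'v \<Rightarrow> 'v" +
  assumes act_add_left: "act (X + Y) v = act X v + act Y v"
    and act_add_right: "act X (v + w) = act X v + act X w"
    and act_mult: "act (X * Y) v = act X (act Y v)"
    and act_one: "act 1 v = v"
    and act_scale: "act (sA c 1) v = sV c v"
    and nonzero: "\<exists>v::'v. v \<noteq> 0"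
    and irreducible: "\<lbrakk>0 \<in> W; \<And>v w. v \<in> W \<Longrightarrow> w \<in> W \<Longrightarrow> v - w \<in> W;
        \<And>X w. w \<in> W \<Longrightarrow> act X w \<in> W\<rbrakk> \<Longrightarrow> W = {0} \<or> W = UNIV"

definition alg_trace :: "('a \<Rightarrow> 'k::field mat) \<Rightarrow> 'a \<Rightarrow> 'k" where
  "alg_trace \<rho> X = (\<Sum>i<dim_row (\<rho> X). \<rho> X $$ (i, i))"

definition poly_at :: "('k::field \<Rightarrow> 'a::ring_1 \<Rightarrow> 'a) \<Rightarrow> 'k poly \<Rightarrow> 'a \<Rightarrow> 'a" where
  "poly_at sA p X = (\<Sum>k\<le>degree p. sA (coeff p k) (X ^ k))"

definition multiplicity_free :: "nat \<Rightarrow> ('a \<Rightarrow> 'k::field mat) \<Rightarrow> 'a \<Rightarrow> bool" where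
  "multiplicity_free d \<rho> X \<longleftrightarrow> card {t. eigenvalue (\<rho> X) t} = d + 1"

text \<open>
  The primitive idempotent of \<open>X\<close> associated with \<open>\<theta> i\<close>.  The factors commute, so the order of
  the list is immaterial.
\<close>

definition primitive_idempotent ::
    "('k::field \<Rightarrow> 'a::ring_1 \<Rightarrow> 'a) \<Rightarrow> nat \<Rightarrow> 'a \<Rightarrow> (nat \<Rightarrow> 'k) \<Rightarrow> nat \<Rightarrow> 'a" where
  "primitive_idempotent sA d X \<theta> i =
    (\<Prod>j\<leftarrow>filter (\<lambda>j. j \<noteq> i) [0..<Suc d]. sA (1 / (\<theta> i - \<theta> j)) (X - sA (\<theta> j) 1))"

text \<open>\<open>\<theta>\<close> orders the eigenvalues of \<open>X\<close>, and \<open>E i\<close> is the primitive idempotent for \<open>\<theta> i\<close>.\<close>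

definition idempotent_ordering ::
    "('k::field \<Rightarrow> 'a::ring_1 \<Rightarrow> 'a) \<Rightarrow> nat \<Rightarrow> ('a \<Rightarrow> 'k mat) \<Rightarrow> 'a \<Rightarrow> (nat \<Rightarrow> 'k) \<Rightarrow> (nat \<Rightarrow> 'a) \<Rightarrow> bool"
  where
  "idempotent_ordering sA d \<rho> X \<theta> E \<longleftrightarrow>
    bij_betw \<theta> {..d} {t. eigenvalue (\<rho> X) t} \<and>
    (\<forall>i\<le>d. E i = primitive_idempotent sA d X \<theta> i)"

definition leonard_system ::
    "('k::field \<Rightarrow> 'a::ring_1 \<Rightarrow> 'a) \<Rightarrow> nat \<Rightarrow> ('a \<Rightarrow> 'k mat) \<Rightarrow>
     'a \<Rightarrow> (nat \<Rightarrow> 'a) \<Rightarrow> 'a \<Rightarrow> (nat \<Rightarrow> 'a) \<Rightarrow> bool" where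
  "leonard_system sA d \<rho> A E As Es \<longleftrightarrow>
    multiplicity_free d \<rho> A \<and> multiplicity_free d \<rho> As \<and>
    (\<exists>\<theta>. idempotent_ordering sA d \<rho> A \<theta> E) \<and>
    (\<exists>\<theta>s. idempotent_ordering sA d \<rho> As \<theta>s Es) \<and>
    (\<forall>i\<le>d. \<forall>j\<le>d. (\<bar>int i - int j\<bar> > 1 \<longrightarrow> E i * As * E j = 0) \<and>
                   (\<bar>int i - int j\<bar> = 1 \<longrightarrow> E i * As * E j \<noteq> 0)) \<and>
    (\<forall>i\<le>d. \<forall>j\<le>d. (\<bar>int i - int j\<bar> > 1 \<longrightarrow> Es i * A * Es j = 0) \<and>
                   (\<bar>int i - int j\<bar> = 1 \<longrightarrow> Es i * A * Es j \<noteq> 0))"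

definition tau_poly :: "(nat \<Rightarrow> 'k::field) \<Rightarrow> nat \<Rightarrow> 'k poly" where
  "tau_poly \<theta> i = (\<Prod>h<i. [:- \<theta> h, 1:])"

definition eta_poly :: "nat \<Rightarrow> (nat \<Rightarrow> 'k::field) \<Rightarrow> nat \<Rightarrow> 'k poly" where
  "eta_poly d \<theta> i = (\<Prod>h<i. [:- \<theta> (d - h), 1:])"

text \<open>
  The sequences \<open>\<theta>\<close>, \<open>\<theta>s\<close> matter only at \<open>0..d\<close>, and \<open>\<phi>1\<close> (first split sequence) and \<open>\<phi>2\<close>
  (second split sequence) only at \<open>1..d\<close>.
\<close>

definition parameter_array ::
    "('k::field \<Rightarrow> 'a::ring_1 \<Rightarrow> 'a) \<Rightarrow> nat \<Rightarrow> ('a \<Rightarrow> 'k mat) \<Rightarrow>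
     'a \<Rightarrow> (nat \<Rightarrow> 'a) \<Rightarrow> 'a \<Rightarrow> (nat \<Rightarrow> 'a) \<Rightarrow>
     (nat \<Rightarrow> 'k) \<Rightarrow> (nat \<Rightarrow> 'k) \<Rightarrow> (nat \<Rightarrow> 'k) \<Rightarrow> (nat \<Rightarrow> 'k) \<Rightarrow> bool" where
  "parameter_array sA d \<rho> A E As Es \<theta> \<theta>s \<phi>1 \<phi>2 \<longleftrightarrow>
    idempotent_ordering sA d \<rho> A \<theta> E \<and>
    idempotent_ordering sA d \<rho> As \<theta>s Es \<and>
    (\<forall>i\<in>{1..d}. \<phi>1 i = (\<theta>s 0 - \<theta>s i) *
       (alg_trace \<rho> (poly_at sA (tau_poly \<theta> i) A * Es 0) /
        alg_trace \<rho> (poly_at sA (tau_poly \<theta> (i - 1)) A * Es 0))) \<and>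
    (\<forall>i\<in>{1..d}. \<phi>2 i = (\<theta>s 0 - \<theta>s i) *
       (alg_trace \<rho> (poly_at sA (eta_poly d \<theta> i) A * Es 0) /
        alg_trace \<rho> (poly_at sA (eta_poly d \<theta> (i - 1)) A * Es 0)))"

definition antiautomorphism ::
    "('k::field \<Rightarrow> 'a::ring_1 \<Rightarrow> 'a) \<Rightarrow> ('a \<Rightarrow> 'a) \<Rightarrow> bool" where
  "antiautomorphism sA dag \<longleftrightarrow>
    Vector_Spaces.linear sA sA dag \<and> bij dag \<and> (\<forall>X Y. dag (X * Y) = dag Y * dag X)"

definition bilinear_form ::
    "('k::field \<Rightarrow> 'v::ab_group_add \<Rightarrow> 'v) \<Rightarrow> ('v \<Rightarrow> 'v \<Rightarrow> 'k) \<Rightarrow> bool" where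
  "bilinear_form sV B \<longleftrightarrow>
    (\<forall>u. Vector_Spaces.linear sV (*) (\<lambda>v. B u v)) \<and>
    (\<forall>v. Vector_Spaces.linear sV (*) (\<lambda>u. B u v))"

end

theory Submission
  imports Defs
begin

text \<open>
  Every identity has the shape \<open>\<Sum>\<^sub>r X\<^sub>r Y\<^sub>r \<cdot> \<eta>\<^sub>i(A) \<xi>\<^sup>*\<^sub>d = X\<^sub>i z\<close>, where \<open>Y\<^sub>r\<close> does not involve
  the sequence \<open>X\<close>.  So it suffices that \<open>Y\<^sub>r \<eta>\<^sub>i(A) \<xi>\<^sup>*\<^sub>d\<close> equals \<open>z\<close> when \<open>r = i\<close> and vanishes
  otherwise; then \<open>X\<close> may be any sequence of algebra elements, and the identities with \<open>X\<^sub>d\<^sub>-\<^sub>r\<close>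
  are those with \<open>X\<^sub>r\<close> for the reversed sequence.

  Two orthogonality relations carry the proof.

  \<^item> \<open>E\<^sup>*\<^sub>0 \<tau>\<^sub>d\<^sub>-\<^sub>r(A) \<eta>\<^sub>i(A) E\<^sup>*\<^sub>d = 0\<close> for \<open>r \<noteq> i\<close> (\<open>tau_eta_orthogonal\<close>).  If \<open>r < i\<close>, the polynomial
    vanishes at every eigenvalue of \<open>A\<close>; if \<open>r > i\<close>, its degree is less than \<open>d\<close>, and \<open>A\<close> is tridiagonal
    with respect to the eigenspaces of \<open>A\<^sup>*\<close>.  For \<open>r = i\<close> it is monic of degree \<open>d\<close>, and for the same
    tridiagonality reason it may be replaced by \<open>\<tau>\<^sub>d\<close> or \<open>\<eta>\<^sub>d\<close>, which are multiples of \<open>E\<^sub>d\<close> and \<open>E\<^sub>0\<close>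
    when evaluated at \<open>A\<close>.
  \<^item> \<open>E\<^sub>d \<eta>\<^sup>*\<^sub>r(A\<^sup>*) \<eta>\<^sub>i(A) \<xi>\<^sup>*\<^sub>d = 0\<close> for \<open>r \<noteq> i\<close>, and it is \<open>\<phi>\<^sub>d \<dots> \<phi>\<^sub>d\<^sub>-\<^sub>r\<^sub>+\<^sub>1 E\<^sub>d \<xi>\<^sup>*\<^sub>d\<close> for \<open>r = i\<close>
    (\<open>eta_dual_eta_orthogonal\<close>).

  The scalars come from the split form.  The vectors \<open>u\<^sub>i = \<tau>\<^sub>i(A) \<xi>\<^sup>*\<^sub>0\<close> span the one-dimensional
  intersections \<open>(E\<^sup>*\<^sub>0V + \<dots> + E\<^sup>*\<^sub>iV) \<inter> (E\<^sub>iV + \<dots> + E\<^sub>dV)\<close>, so \<open>(A\<^sup>* - \<theta>\<^sup>*\<^sub>i) u\<^sub>i\<close> is a nonzero multiple of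
  \<open>u\<^sub>i\<^sub>-\<^sub>1\<close> (\<open>split_lower\<close>).  Projecting to \<open>E\<^sup>*\<^sub>0V\<close> identifies the multiple with \<open>\<phi>\<^sub>i\<close>, as defined by a
  quotient of traces, and \<open>\<phi>\<^sub>1 \<dots> \<phi>\<^sub>d\<close> telescopes to \<open>\<eta>\<^sup>*\<^sub>d(\<theta>\<^sup>*\<^sub>0) tr(\<tau>\<^sub>d(A) E\<^sup>*\<^sub>0)\<close>
  (\<open>split_parameters\<close>).  The same argument for the system with both orderings reversed gives
  \<open>(A\<^sup>* - \<theta>\<^sup>*\<^sub>d\<^sub>-\<^sub>i) w\<^sub>i = \<psi>\<^sub>i w\<^sub>i\<^sub>-\<^sub>1\<close> for \<open>w\<^sub>i = \<eta>\<^sub>i(A) \<xi>\<^sup>*\<^sub>d\<close>.  The bilinear form makes the two split bases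
  dual to each other, \<open>\<langle>u\<^sub>i, w\<^sub>j\<rangle> = 0\<close> unless \<open>i + j = d\<close>; moving \<open>A\<close> and \<open>A\<^sup>*\<close> across the form yields
  \<open>\<psi>\<^sub>i = \<phi>\<^sub>d\<^sub>-\<^sub>i\<^sub>+\<^sub>1\<close> (\<open>split_parameters_agree\<close>).

  All of this is linear algebra on \<open>V\<close> that only uses the projections to the eigenspaces, so it is
  developed for operators on a vector space.  The algebra enters through three facts: coordinates in
  an eigenbasis of \<open>A\<close> turn \<open>E\<^sub>i\<close> into a diagonal matrix unit, whence \<open>E\<^sub>i Y E\<^sub>i = tr(Y E\<^sub>i) E\<^sub>i\<close>; the
  action on \<open>V\<close> is faithful; and \<open>\<dagger>\<close> fixes each \<open>E\<^sub>i\<close>, as a polynomial in \<open>A\<close>, so that \<open>E\<^sub>i\<close> is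
  self-adjoint for the bilinear form.
\<close>

section \<open>Diagonalizable operators with one-dimensional eigenspaces\<close>

text \<open>
  The operator is given by the projections \<open>e i\<close> to its eigenspaces and its eigenvalues \<open>\<theta> i\<close>, not
  as a map of its own.  The axiom \<open>proj_line\<close> says that an eigenspace has dimension at most one.
\<close>

locale spectral_decomposition = vector_space scale
  for scale :: "'k::field \<Rightarrow> 'v::ab_group_add \<Rightarrow> 'v" (infixr "*s" 75) +
  fixes d :: nat and e :: "nat \<Rightarrow> 'v \<Rightarrow> 'v" and \<theta> :: "nat \<Rightarrow> 'k"
  assumes proj_add: "i \<le> d \<Longrightarrow> e i (v + w) = e i v + e i w"
    and proj_scale: "i \<le> d \<Longrightarrow> e i (c *s v) = c *s e i v"
    and proj_proj: "i \<le> d \<Longrightarrow> j \<le> d \<Longrightarrow> e i (e j v) = (if i = j then e j v else 0)"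
    and proj_sum: "(\<Sum>i\<le>d. e i v) = v"
    and proj_line: "i \<le> d \<Longrightarrow> e i v \<noteq> 0 \<Longrightarrow> \<exists>c. e i w = c *s e i v"
begin

text \<open>
  The value of the polynomial at the operator.  In this form, identities between polynomials at the
  operator reduce to identities between their values at the eigenvalues.
\<close>

definition ev :: "'k poly \<Rightarrow> 'v \<Rightarrow> 'v" where
  "ev p v = (\<Sum>i\<le>d. poly p (\<theta> i) *s e i v)"

lemma proj_0: "i \<le> d \<Longrightarrow> e i 0 = 0"
  using proj_scale[of i 0 0] by simp

lemma proj_diff: "i \<le> d \<Longrightarrow> e i (v - w) = e i v - e i w"
  using proj_add[of i "v - w" w] by (simp add: algebra_simps)

lemma proj_distrib_sum: "i \<le> d \<Longrightarrow> e i (\<Sum>x\<in>S. g x) = (\<Sum>x\<in>S. e i (g x))"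
  by (induction S rule: infinite_finite_induct) (simp_all add: proj_0 proj_add)

lemma eq_by_proj: "(\<And>i. i \<le> d \<Longrightarrow> e i v = e i w) \<Longrightarrow> v = w"
  using proj_sum[of v] proj_sum[of w] by (metis (no_types, lifting) atMost_iff sum.cong)

lemma proj_ev: assumes "i \<le> d" shows "e i (ev p v) = poly p (\<theta> i) *s e i v"
proof -
  have "e i (ev p v) = (\<Sum>j\<le>d. poly p (\<theta> j) *s e i (e j v))"
    unfolding ev_def using assms by (simp add: proj_distrib_sum proj_scale)
  also have "\<dots> = (\<Sum>j\<le>d. if i = j then poly p (\<theta> j) *s e j v else 0)"
    using assms by (intro sum.cong) (auto simp: proj_proj)
  finally show ?thesis using assms by simp
qed

lemma ev_eqI: "(\<And>i. i \<le> d \<Longrightarrow> poly p (\<theta> i) *s e i v = e i w) \<Longrightarrow> ev p v = w"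
  by (rule eq_by_proj) (simp add: proj_ev)

lemma ev_add: "ev p (v + w) = ev p v + ev p w"
  by (rule ev_eqI) (simp add: proj_add proj_ev scale_right_distrib)

lemma ev_scale: "ev p (c *s v) = c *s ev p v"
  by (rule ev_eqI) (simp add: proj_scale proj_ev mult.commute)

lemma ev_0: "ev p 0 = 0"
  by (rule ev_eqI) (simp add: proj_0)

lemma ev_distrib_sum: "ev p (\<Sum>x\<in>S. g x) = (\<Sum>x\<in>S. ev p (g x))"
  by (induction S rule: infinite_finite_induct) (simp_all add: ev_0 ev_add)

lemma ev_mult: "ev (p * q) v = ev p (ev q v)"
  by (rule ev_eqI) (simp add: proj_ev)

lemma ev_poly_diff: "ev (p - q) v = ev p v - ev q v"
  by (rule ev_eqI) (simp add: proj_ev proj_diff scale_left_diff_distrib)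

lemma ev_zero_poly: "ev 0 v = 0"
  by (rule ev_eqI) (simp add: proj_0)

lemma ev_1: "ev 1 v = v"
  by (rule ev_eqI) simp

lemma ev_pCons: "ev (pCons c q) v = c *s v + ev [:0, 1:] (ev q v)"
  by (rule ev_eqI) (simp add: proj_ev proj_add proj_scale scale_left_distrib)

lemma ev_linear_factor: "ev [:- t, 1:] v = ev [:0, 1:] v - t *s v"
  by (rule ev_eqI) (simp add: proj_ev proj_diff proj_scale scale_left_diff_distrib algebra_simps)

lemma ev_on_proj: assumes "i \<le> d" "e i v = v" shows "ev p v = poly p (\<theta> i) *s v"
  by (rule ev_eqI) (metis assms proj_proj proj_scale scale_zero_right)

text \<open>
  The axioms survive a reversal of the order of the eigenspaces.  The polynomials \<open>\<eta>\<^sub>i\<close> are the \<open>\<tau>\<^sub>i\<close>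
  of the reversed order, so every statement about \<open>\<tau>\<close> yields one about \<open>\<eta>\<close>.
\<close>

lemma spectral_decomposition_reverse:
  "spectral_decomposition scale d (\<lambda>i. e (d - i))"
proof unfold_locales
  fix v show "(\<Sum>i\<le>d. e (d - i) v) = v"
    using sum.nat_diff_reindex[of "\<lambda>i. e i v" "Suc d"] proj_sum[of v]
    by (simp add: lessThan_Suc_atMost)
qed (auto simp: proj_add proj_scale proj_proj intro: proj_line)

lemma ev_reverse:
  "spectral_decomposition.ev scale d (\<lambda>i. e (d - i)) (\<lambda>i. \<theta> (d - i)) = ev"
  unfolding spectral_decomposition.ev_def[OF spectral_decomposition_reverse] ev_def
  using sum.nat_diff_reindex[of "\<lambda>i. poly p (\<theta> i) *s e i v" "Suc d" for p v]
  by (simp add: lessThan_Suc_atMost fun_eq_iff)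

end

lemma tau_poly_0 [simp]: "tau_poly \<theta> 0 = 1"
  by (simp add: tau_poly_def)

lemma tau_poly_Suc: "tau_poly \<theta> (Suc i) = [:- \<theta> i, 1:] * tau_poly \<theta> i"
  by (simp add: tau_poly_def lessThan_Suc)

lemma eta_poly_eq_tau_poly: "eta_poly d \<theta> i = tau_poly (\<lambda>h. \<theta> (d - h)) i"
  by (simp add: tau_poly_def eta_poly_def)

lemma poly_tau_poly: "poly (tau_poly \<theta> i) x = (\<Prod>h<i. x - \<theta> h)"
  by (simp add: tau_poly_def poly_prod)

lemma degree_tau_poly [simp]: "degree (tau_poly \<theta> i) = i"
  unfolding tau_poly_def by (subst degree_prod_eq_sum_degree) auto

lemma monic_tau_poly [simp]: "coeff (tau_poly \<theta> i) i = 1"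
  using lead_coeff_prod[of "\<lambda>h. [:- \<theta> h, 1:]" "{..<i}"] degree_tau_poly[of \<theta> i]
  by (simp add: tau_poly_def)

lemma tau_poly_nonzero [simp]: "tau_poly \<theta> i \<noteq> 0"
  by (metis coeff_0 monic_tau_poly zero_neq_one)

lemma degree_eta_poly [simp]: "degree (eta_poly d \<theta> i) = i"
  by (simp add: eta_poly_eq_tau_poly)

lemma monic_eta_poly [simp]: "coeff (eta_poly d \<theta> i) i = 1"
  by (simp add: eta_poly_eq_tau_poly)

lemma eta_poly_nonzero [simp]: "eta_poly d \<theta> i \<noteq> 0"
  by (simp add: eta_poly_eq_tau_poly)

section \<open>Operators acting tridiagonally on the eigenspaces of another\<close>

text \<open>
  One half of the Leonard conditions: the operator with projections \<open>e i\<close> is irreducible tridiagonal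
  with respect to the projections \<open>f i\<close>.  Stating the halves separately lets each lemma below be used
  a second time with the roles of the two operators exchanged.
\<close>

locale tridiagonal_operators =
  fst: spectral_decomposition scale d e \<theta> + snd: spectral_decomposition scale d f \<theta>s
  for scale :: "'k::field \<Rightarrow> 'v::ab_group_add \<Rightarrow> 'v" (infixr "*s" 75) and d e \<theta> f \<theta>s +
  assumes tri: "i \<le> d \<Longrightarrow> j \<le> d \<Longrightarrow> \<bar>int i - int j\<bar> > 1 \<Longrightarrow> f i (fst.ev [:0, 1:] (f j v)) = 0"
    and tri_up: "i < d \<Longrightarrow> f i v \<noteq> 0 \<Longrightarrow> f (Suc i) (fst.ev [:0, 1:] (f i v)) \<noteq> 0"
    and tri_down: "i < d \<Longrightarrow> f (Suc i) v \<noteq> 0 \<Longrightarrow> f i (fst.ev [:0, 1:] (f (Suc i) v)) \<noteq> 0"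
begin

text \<open>
  A single application of a tridiagonal operator moves between neighbouring eigenspaces only, so a
  polynomial needs degree at least \<open>\<bar>i - j\<bar>\<close> to connect the \<open>j\<close>-th one with the \<open>i\<close>-th.  The bound on
  the degree is phrased by coefficients to include the zero polynomial.
\<close>

lemma tri_poly:
  assumes "i \<le> d" "j \<le> d" "\<And>k. \<bar>int i - int j\<bar> \<le> int k \<Longrightarrow> coeff p k = 0"
  shows "f i (fst.ev p (f j v)) = 0"
  using assms
proof (induction p arbitrary: i)
  case 0
  then show ?case by (simp add: fst.ev_zero_poly snd.proj_0)
next
  case (pCons c q)
  have 1: "c *s f i (f j v) = 0"
    using pCons.prems(1,2) pCons.prems(3)[of 0] by (cases "i = j") (simp_all add: snd.proj_proj)
  have 2: "f i (fst.ev [:0, 1:] (f k (fst.ev q (f j v)))) = 0" if k: "k \<le> d" for k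
  proof (cases "\<bar>int i - int k\<bar> > 1")
    case True
    then show ?thesis using k pCons.prems by (simp add: tri)
  next
    case False
    have "f k (fst.ev q (f j v)) = 0"
    proof (rule pCons.IH)
      fix l assume "\<bar>int k - int j\<bar> \<le> int l"
      then have "\<bar>int i - int j\<bar> \<le> int (Suc l)" using False by linarith
      then have "coeff (pCons c q) (Suc l) = 0" by (rule pCons.prems)
      then show "coeff q l = 0" by simp
    qed (use k pCons.prems in auto)
    then show ?thesis using pCons.prems by (simp add: fst.ev_0 snd.proj_0)
  qed
  have "f i (fst.ev [:0, 1:] (fst.ev q (f j v)))
      = f i (fst.ev [:0, 1:] (\<Sum>k\<le>d. f k (fst.ev q (f j v))))"
    by (simp add: snd.proj_sum)
  also have "\<dots> = 0"
    using pCons.prems 2 by (simp add: fst.ev_distrib_sum snd.proj_distrib_sum)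
  finally show ?case
    using 1 pCons.prems by (subst fst.ev_pCons) (simp add: snd.proj_add snd.proj_scale)
qed

text \<open>
  A linear factor moves the highest nonzero component up by exactly one place: only the entry of the
  tridiagonal matrix below the diagonal can reach that place, and it is nonzero.
\<close>

lemma proj_linear_factor_top:
  assumes k: "k < d" and y: "f k y \<noteq> 0" and z: "\<And>j. k < j \<Longrightarrow> j \<le> d \<Longrightarrow> f j y = 0"
  shows "f (Suc k) (fst.ev [:- t, 1:] y) \<noteq> 0"
    and "\<And>j. Suc k < j \<Longrightarrow> j \<le> d \<Longrightarrow> f j (fst.ev [:- t, 1:] y) = 0"
proof -
  have eq: "f j (fst.ev [:- t, 1:] y) = (\<Sum>l\<le>d. f j (fst.ev [:0, 1:] (f l y))) - t *s f j y"
    if "j \<le> d" for j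
    using that fst.ev_distrib_sum[of "[:0,1:]" "\<lambda>l. f l y" "{..d}"]
    by (simp add: fst.ev_linear_factor snd.proj_diff snd.proj_scale snd.proj_sum flip: snd.proj_distrib_sum)
  have vanish: "f j (fst.ev [:0, 1:] (f l y)) = 0" if "j \<le> d" "l \<le> d" "Suc l < j \<or> k < l" for j l
    using that tri[of j l y] z[of l] by (auto simp: fst.ev_0 snd.proj_0)
  have "(\<Sum>l\<le>d. f (Suc k) (fst.ev [:0, 1:] (f l y)))
      = (\<Sum>l\<in>{k}. f (Suc k) (fst.ev [:0, 1:] (f l y)))"
    using k by (intro sum.mono_neutral_right) (auto intro!: vanish)
  then show "f (Suc k) (fst.ev [:- t, 1:] y) \<noteq> 0"
    using eq[of "Suc k"] k z tri_up[OF k y] by simp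
  show "f j (fst.ev [:- t, 1:] y) = 0" if "Suc k < j" "j \<le> d" for j
  proof -
    have "(\<Sum>l\<le>d. f j (fst.ev [:0, 1:] (f l y))) = 0"
      using that by (intro sum.neutral ballI vanish) auto
    then show ?thesis using eq[of j] that z by simp
  qed
qed

lemma proj_tau_poly_top:
  assumes "f k y \<noteq> 0" and "\<And>j. k < j \<Longrightarrow> j \<le> d \<Longrightarrow> f j y = 0" and "k + n \<le> d"
  shows "f (k + n) (fst.ev (tau_poly t n) y) \<noteq> 0 \<and>
    (\<forall>j. k + n < j \<longrightarrow> j \<le> d \<longrightarrow> f j (fst.ev (tau_poly t n) y) = 0)"
  using assms(3)
proof (induction n)
  case 0
  then show ?case using assms by (simp add: fst.ev_1)
next
  case (Suc n)
  then show ?case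
    using proj_linear_factor_top[where k = "k + n" and y = "fst.ev (tau_poly t n) y" and t = "t n"]
    by (simp add: tau_poly_Suc fst.ev_mult del: mult_pCons_left)
qed

text \<open>
  This is \<open>(f\<^sub>0V + \<dots> + f\<^sub>m\<^sub>-\<^sub>1V) \<inter> (e\<^sub>mV + \<dots> + e\<^sub>dV) = 0\<close>.  A vector in the second space is killed by a
  monic polynomial of degree \<open>d + 1 - m\<close>.  If its highest nonzero \<open>f\<close>-component is the \<open>k\<close>-th one with
  \<open>k < m\<close>, the same polynomial moves that component up to position \<open>k + d + 1 - m \<le> d\<close> without
  destroying it.
\<close>

lemma split_intersection_trivial:
  assumes m: "m \<le> d" and f0: "\<And>j. m \<le> j \<Longrightarrow> j \<le> d \<Longrightarrow> f j y = 0"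
    and e0: "\<And>j. j < m \<Longrightarrow> e j y = 0"
  shows "y = 0"
proof (rule ccontr)
  assume "y \<noteq> 0"
  define S where "S = {k. k \<le> d \<and> f k y \<noteq> 0}"
  have "S \<noteq> {}" using \<open>y \<noteq> 0\<close> snd.eq_by_proj[of y 0] by (auto simp: S_def snd.proj_0)
  moreover have "finite S" by (simp add: S_def)
  ultimately have "Max S \<in> S" and mx: "\<And>j. j \<in> S \<Longrightarrow> j \<le> Max S" by auto
  define k where "k = Max S"
  have k: "k \<le> d" "f k y \<noteq> 0" using \<open>Max S \<in> S\<close> by (auto simp: S_def k_def)
  have kz: "f j y = 0" if "k < j" "j \<le> d" for j
    using mx[of j] that by (metis (mono_tags, lifting) S_def k_def mem_Collect_eq not_less)
  have "k < m" using k f0[of k] by (meson not_less)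
  \<comment> \<open>The roots of this polynomial are \<open>\<theta>\<^sub>d, \<theta>\<^sub>d\<^sub>-\<^sub>1, \<dots>, \<theta>\<^sub>m\<close>.\<close>
  let ?p = "tau_poly (\<lambda>h. \<theta> (d - h)) (Suc d - m)"
  have "fst.ev ?p y = 0"
  proof (rule fst.ev_eqI)
    fix j assume j: "j \<le> d"
    show "poly ?p (\<theta> j) *s e j y = e j 0"
    proof (cases "j < m")
      case True
      then show ?thesis using e0 j by (simp add: fst.proj_0)
    next
      case False
      then have "poly ?p (\<theta> j) = 0"
        using j by (auto simp: poly_tau_poly intro!: bexI[of _ "d - j"])
      then show ?thesis using j by (simp add: fst.proj_0)
    qed
  qed
  moreover have "k + (Suc d - m) \<le> d" using \<open>k < m\<close> m by linarith
  ultimately show False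
    using proj_tau_poly_top[of k y "Suc d - m" "\<lambda>h. \<theta> (d - h)"] k kz
    by (simp add: snd.proj_0)
qed

lemma tridiagonal_operators_reverse:
  "tridiagonal_operators scale d e \<theta> (\<lambda>i. f (d - i))"
proof (intro tridiagonal_operators.intro tridiagonal_operators_axioms.intro)
  show "spectral_decomposition scale d e" ..
  show "spectral_decomposition scale d (\<lambda>i. f (d - i))"
    by (rule snd.spectral_decomposition_reverse)
  show "f (d - i) (fst.ev [:0, 1:] (f (d - j) v)) = 0"
    if "i \<le> d" "j \<le> d" "1 < \<bar>int i - int j\<bar>" for i j v
    using that by (intro tri) auto
  show "f (d - Suc i) (fst.ev [:0, 1:] (f (d - i) v)) \<noteq> 0" if "i < d" "f (d - i) v \<noteq> 0" for i v
    using tri_down[of "d - Suc i" v] that by (simp add: Suc_diff_Suc)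
  show "f (d - i) (fst.ev [:0, 1:] (f (d - Suc i) v)) \<noteq> 0"
    if "i < d" "f (d - Suc i) v \<noteq> 0" for i v
    using tri_up[of "d - Suc i" v] that by (simp add: Suc_diff_Suc)
qed

lemma tridiagonal_operators_reverse_first:
  "tridiagonal_operators scale d (\<lambda>i. e (d - i)) (\<lambda>i. \<theta> (d - i)) f"
  unfolding tridiagonal_operators_def tridiagonal_operators_axioms_def fst.ev_reverse
  using fst.spectral_decomposition_reverse snd.spectral_decomposition_axioms tri tri_up tri_down
  by blast

text \<open>
  The components of an eigenvector of an irreducible tridiagonal operator satisfy a three-term
  recurrence, which determines all of them from the component at the end.
\<close>

lemma eigenvector_proj_0:
  assumes v: "fst.ev [:- t, 1:] v = 0" and v0: "f 0 v = 0"
  shows "v = 0"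
proof -
  have av: "fst.ev [:0, 1:] v = t *s v" using v by (simp add: fst.ev_linear_factor)
  have "\<forall>j\<le>k. f j v = 0" if "k \<le> d" for k
    using that
  proof (induction k)
    case (Suc k)
    have *: "f j v = 0" if "j \<le> k" for j using Suc that by simp
    have "0 = f k (fst.ev [:0, 1:] v)" using Suc av * by (simp add: snd.proj_scale)
    also have "\<dots> = (\<Sum>l\<le>d. f k (fst.ev [:0, 1:] (f l v)))"
      using Suc.prems fst.ev_distrib_sum[of "[:0,1:]" "\<lambda>l. f l v" "{..d}"]
      by (simp add: snd.proj_sum flip: snd.proj_distrib_sum)
    also have "\<dots> = (\<Sum>l\<in>{Suc k}. f k (fst.ev [:0, 1:] (f l v)))"
    proof (intro sum.mono_neutral_right ballI)
      fix l assume l: "l \<in> {..d} - {Suc k}"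
      then have "l \<le> k \<or> Suc k < l" by auto
      then show "f k (fst.ev [:0, 1:] (f l v)) = 0"
        using l Suc.prems * tri[of k l v] by (auto simp: fst.ev_0 snd.proj_0)
    qed (use Suc in auto)
    finally have "f k (fst.ev [:0, 1:] (f (Suc k) v)) = 0" by simp
    then have "f (Suc k) v = 0" using tri_down[of k v] Suc.prems by auto
    then show ?case using * by (auto simp: le_Suc_eq)
  qed (use v0 in simp)
  then show ?thesis using snd.eq_by_proj[of v 0] by (simp add: snd.proj_0)
qed

end

section \<open>The split basis\<close>

locale leonard_operators =
  tridiagonal_operators scale d e \<theta> f \<theta>s + dual: tridiagonal_operators scale d f \<theta>s e \<theta>
  for scale :: "'k::field \<Rightarrow> 'v::ab_group_add \<Rightarrow> 'v" (infixr "*s" 75) and d e \<theta> f \<theta>s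
begin

lemma leonard_operators_reverse_first:
  "leonard_operators scale d (\<lambda>i. e (d - i)) (\<lambda>i. \<theta> (d - i)) f \<theta>s"
  by (intro leonard_operators.intro tridiagonal_operators_reverse_first
      dual.tridiagonal_operators_reverse)

lemma leonard_operators_reverse_second:
  "leonard_operators scale d e \<theta> (\<lambda>i. f (d - i)) (\<lambda>i. \<theta>s (d - i))"
  by (intro leonard_operators.intro tridiagonal_operators_reverse
      dual.tridiagonal_operators_reverse_first)

lemma split_intersection_line:
  assumes m: "m \<le> d" and u: "f m u \<noteq> 0"
    and fz: "\<And>j. m < j \<Longrightarrow> j \<le> d \<Longrightarrow> f j u = 0 \<and> f j x = 0"
    and ez: "\<And>j. j < m \<Longrightarrow> e j u = 0 \<and> e j x = 0"
  shows "\<exists>c. x = c *s u"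
proof -
  obtain c where c: "f m x = c *s f m u" using snd.proj_line[OF m u] by blast
  have "x - c *s u = 0"
  proof (rule split_intersection_trivial[OF m])
    fix j assume "m \<le> j" "j \<le> d"
    then show "f j (x - c *s u) = 0"
      using c fz[of j] by (cases "j = m") (auto simp: snd.proj_diff snd.proj_scale)
  next
    fix j assume "j < m"
    then show "e j (x - c *s u) = 0"
      using ez[of j] m by (simp add: fst.proj_diff fst.proj_scale)
  qed
  then show ?thesis by auto
qed

text \<open>
  The vectors \<open>\<tau>\<^sub>i(a) \<xi>\<close>, where \<open>a\<close> is the operator belonging to \<open>e\<close> and \<open>\<xi>\<close> spans the first eigenspace of
  the other one, have triangular supports in both decompositions.
\<close>

lemma split_vector:
  assumes "f 0 \<xi> = \<xi>" "\<xi> \<noteq> 0" "i \<le> d"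
  shows "f i (fst.ev (tau_poly \<theta> i) \<xi>) \<noteq> 0"
    and "\<And>j. i < j \<Longrightarrow> j \<le> d \<Longrightarrow> f j (fst.ev (tau_poly \<theta> i) \<xi>) = 0"
    and "\<And>j. j < i \<Longrightarrow> e j (fst.ev (tau_poly \<theta> i) \<xi>) = 0"
proof -
  have z: "f j \<xi> = 0" if "0 < j" "j \<le> d" for j
    using snd.proj_proj[of j 0 \<xi>] that assms by simp
  show "f i (fst.ev (tau_poly \<theta> i) \<xi>) \<noteq> 0"
    and "\<And>j. i < j \<Longrightarrow> j \<le> d \<Longrightarrow> f j (fst.ev (tau_poly \<theta> i) \<xi>) = 0"
    using proj_tau_poly_top[of 0 \<xi> i \<theta>] z assms by auto
  show "e j (fst.ev (tau_poly \<theta> i) \<xi>) = 0" if "j < i" for j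
    using that assms by (auto simp: fst.proj_ev poly_tau_poly)
qed

text \<open>
  The left-hand side lies in \<open>(f\<^sub>0V + \<dots> + f\<^sub>iV) \<inter> (e\<^sub>iV + \<dots> + e\<^sub>dV)\<close>: the linear factor removes the
  component in \<open>f\<^sub>i\<^sub>+\<^sub>1V\<close>, and tridiagonality allows one step down in the \<open>e\<close>-decomposition.  This
  intersection is the line through \<open>\<tau>\<^sub>i(a) \<xi>\<close>.  With \<open>c = 0\<close>, the vector \<open>\<tau>\<^sub>i\<^sub>+\<^sub>1(a) \<xi>\<close> would be an
  eigenvector without \<open>e\<^sub>0\<close>-component.
\<close>

lemma split_lower:
  assumes \<xi>: "f 0 \<xi> = \<xi>" "\<xi> \<noteq> 0" and i: "i < d"
  shows "\<exists>c. c \<noteq> 0 \<and> snd.ev [:- \<theta>s (Suc i), 1:] (fst.ev (tau_poly \<theta> (Suc i)) \<xi>)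
    = c *s fst.ev (tau_poly \<theta> i) \<xi>"
proof -
  define u where "u i = fst.ev (tau_poly \<theta> i) \<xi>" for i
  note sv = split_vector[OF \<xi>, folded u_def]
  define x where "x = snd.ev [:- \<theta>s (Suc i), 1:] (u (Suc i))"
  have "\<exists>c. x = c *s u i"
  proof (rule split_intersection_line)
    show "f i (u i) \<noteq> 0" using sv(1) i by simp
    show "f j (u i) = 0 \<and> f j x = 0" if "i < j" "j \<le> d" for j
      using sv(2)[of i j] sv(2)[of "Suc i" j] i that
      by (cases "j = Suc i") (auto simp: x_def snd.proj_ev)
    show "e j (u i) = 0 \<and> e j x = 0" if j: "j < i" for j
    proof -
      have "e j (snd.ev [:0, 1:] (u (Suc i))) = (\<Sum>l\<le>d. e j (snd.ev [:0, 1:] (e l (u (Suc i)))))"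
        using j i snd.ev_distrib_sum[of "[:0,1:]" "\<lambda>l. e l (u (Suc i))" "{..d}"]
        by (simp add: fst.proj_sum flip: fst.proj_distrib_sum)
      also have "\<dots> = 0"
      proof (intro sum.neutral ballI)
        fix l assume l: "l \<in> {..d}"
        show "e j (snd.ev [:0, 1:] (e l (u (Suc i)))) = 0"
          using j i l sv(3)[of "Suc i" l] dual.tri[of j l "u (Suc i)"]
          by (cases "l < Suc i") (auto simp: snd.ev_0 fst.proj_0)
      qed
      finally show ?thesis
        using sv(3)[of i j] sv(3)[of "Suc i" j] j i
        by (simp add: x_def snd.ev_linear_factor fst.proj_diff fst.proj_scale)
    qed
  qed (use i in simp)
  then obtain c where c: "x = c *s u i" by blast
  have "c \<noteq> 0"
  proof
    assume "c = 0"
    then have "snd.ev [:- \<theta>s (Suc i), 1:] (u (Suc i)) = 0" using c by (simp add: x_def)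
    moreover have "e 0 (u (Suc i)) = 0" using sv(3)[of "Suc i" 0] i by simp
    ultimately have "u (Suc i) = 0" by (rule dual.eigenvector_proj_0)
    then show False using sv(1)[of "Suc i"] i by (simp add: snd.proj_0)
  qed
  then show ?thesis using c by (auto simp: x_def u_def)
qed

text \<open>
  \<open>T i\<close> stands for the trace \<open>tr(\<tau>\<^sub>i(A) E\<^sup>*\<^sub>0)\<close>, and \<open>\<phi>\<close> for the first split sequence as defined from
  it.  Applying \<open>f 0\<close> to the relation in \<open>split_lower\<close> gives \<open>(\<theta>\<^sup>*\<^sub>0 - \<theta>\<^sup>*\<^sub>i\<^sub>+\<^sub>1) T\<^sub>i\<^sub>+\<^sub>1 = c T\<^sub>i\<close> with
  \<open>c \<noteq> 0\<close>.  Hence, by induction, no \<open>T i\<close> vanishes; so the quotients defining \<open>\<phi>\<close> are genuine ones,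
  their values are the numbers \<open>c\<close>, and their product telescopes.
\<close>

lemma split_parameters:
  assumes \<xi>: "f 0 \<xi> = \<xi>" "\<xi> \<noteq> 0"
    and T: "\<And>i. i \<le> d \<Longrightarrow> f 0 (fst.ev (tau_poly \<theta> i) \<xi>) = T i *s \<xi>"
    and \<phi>: "\<And>i. 1 \<le> i \<Longrightarrow> i \<le> d \<Longrightarrow> \<phi> i = (\<theta>s 0 - \<theta>s i) * (T i / T (i - 1))"
  shows "\<And>i. i < d \<Longrightarrow> snd.ev [:- \<theta>s (Suc i), 1:] (fst.ev (tau_poly \<theta> (Suc i)) \<xi>)
            = \<phi> (Suc i) *s fst.ev (tau_poly \<theta> i) \<xi>"
    and "\<And>i. 1 \<le> i \<Longrightarrow> i \<le> d \<Longrightarrow> \<phi> i \<noteq> 0"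
    and "T d \<noteq> 0"
    and "(\<Prod>h=1..d. \<phi> h) = poly (eta_poly d \<theta>s d) (\<theta>s 0) * T d"
proof -
  have T0: "T 0 = 1"
  proof -
    have "1 *s \<xi> = T 0 *s \<xi>" using T[of 0] \<xi> by (simp add: fst.ev_1)
    then show ?thesis using \<xi>(2) by (simp only: fst.scale_cancel_right) simp
  qed
  have step: "T (Suc i) \<noteq> 0 \<and> \<phi> (Suc i) \<noteq> 0 \<and> 
      snd.ev [:- \<theta>s (Suc i), 1:] (fst.ev (tau_poly \<theta> (Suc i)) \<xi>)
            = \<phi> (Suc i) *s fst.ev (tau_poly \<theta> i) \<xi>" if i: "i < d" and Ti: "T i \<noteq> 0" for i
  proof -
    obtain c where c: "c \<noteq> 0" "snd.ev [:- \<theta>s (Suc i), 1:] (fst.ev (tau_poly \<theta> (Suc i)) \<xi>)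
        = c *s fst.ev (tau_poly \<theta> i) \<xi>"
      using split_lower[OF \<xi> i] by blast
    have "((\<theta>s 0 - \<theta>s (Suc i)) * T (Suc i)) *s \<xi> = (c * T i) *s \<xi>"
      using arg_cong[OF c(2), of "f 0"] T[of i] T[of "Suc i"] i
      by (simp add: snd.proj_ev snd.proj_scale)
    then have eq: "(\<theta>s 0 - \<theta>s (Suc i)) * T (Suc i) = c * T i"
      using \<xi>(2) by (simp only: fst.scale_cancel_right) simp
    then have "\<phi> (Suc i) = c" using \<phi>[of "Suc i"] Ti i by (simp add: field_simps)
    then show ?thesis using eq c Ti by auto
  qed
  have Tn: "T i \<noteq> 0" if "i \<le> d" for i
    using that by (induction i) (use step T0 in auto)
  show "\<And>i. i < d \<Longrightarrow> snd.ev [:- \<theta>s (Suc i), 1:] (fst.ev (tau_poly \<theta> (Suc i)) \<xi>)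
            = \<phi> (Suc i) *s fst.ev (tau_poly \<theta> i) \<xi>"
    using step Tn by simp
  show "\<phi> i \<noteq> 0" if "1 \<le> i" "i \<le> d" for i
    using step[of "i - 1"] Tn[of "i - 1"] that by simp
  show "T d \<noteq> 0" using Tn by simp
  have "(\<Prod>h=1..n. \<phi> h) = (\<Prod>h=1..n. \<theta>s 0 - \<theta>s h) * T n" if "n \<le> d" for n
    using that
  proof (induction n)
    case (Suc n)
    have "\<phi> (Suc n) * T n = (\<theta>s 0 - \<theta>s (Suc n)) * T (Suc n)"
      using \<phi>[of "Suc n"] Tn[of n] Suc.prems by simp
    then have "(\<Prod>h=1..n. \<theta>s 0 - \<theta>s h) * T n * \<phi> (Suc n)
        = (\<Prod>h=1..n. \<theta>s 0 - \<theta>s h) * (\<theta>s 0 - \<theta>s (Suc n)) * T (Suc n)"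
      by (simp only: mult.assoc mult.commute[of "T n"])
    then show ?case using Suc by simp
  qed (simp add: T0)
  moreover have "poly (eta_poly d \<theta>s d) (\<theta>s 0) = (\<Prod>h=1..d. \<theta>s 0 - \<theta>s h)"
    unfolding eta_poly_eq_tau_poly poly_tau_poly
    by (rule prod.reindex_bij_witness[of _ "\<lambda>h. d - h" "\<lambda>h. d - h"]) auto
  ultimately show "(\<Prod>h=1..d. \<phi> h) = poly (eta_poly d \<theta>s d) (\<theta>s 0) * T d" by simp
qed

text \<open>
  The next three lemmas transport the split basis to reversed orders of the eigenspaces: of both
  decompositions in the first two, where the starting vector lies in \<open>f\<^sub>dV\<close>, and of the first
  decomposition only in the third, which yields the second split sequence.
\<close>

lemma eta_vector:
  assumes \<xi>: "f d \<xi> = \<xi>" "\<xi> \<noteq> 0" and i: "i \<le> d"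
  shows "\<And>j. j < d - i \<Longrightarrow> f j (fst.ev (eta_poly d \<theta> i) \<xi>) = 0"
    and "\<And>j. d - i < j \<Longrightarrow> j \<le> d \<Longrightarrow> e j (fst.ev (eta_poly d \<theta> i) \<xi>) = 0"
proof -
  interpret r: leonard_operators scale d "\<lambda>i. e (d - i)" "\<lambda>i. \<theta> (d - i)" f \<theta>s
    by (rule leonard_operators_reverse_first)
  interpret r: leonard_operators scale d "\<lambda>i. e (d - i)" "\<lambda>i. \<theta> (d - i)"
    "\<lambda>i. f (d - i)" "\<lambda>i. \<theta>s (d - i)"
    by (rule r.leonard_operators_reverse_second)
  note sv = r.split_vector[unfolded fst.ev_reverse, folded eta_poly_eq_tau_poly, of \<xi> i]
  show "f j (fst.ev (eta_poly d \<theta> i) \<xi>) = 0" if "j < d - i" for j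
    using sv(2)[of "d - j"] that \<xi> i by auto
  show "e j (fst.ev (eta_poly d \<theta> i) \<xi>) = 0" if "d - i < j" "j \<le> d" for j
    using sv(3)[of "d - j"] that \<xi> i by auto
qed

lemma eta_lower:
  assumes \<xi>: "f d \<xi> = \<xi>" "\<xi> \<noteq> 0" and i: "i < d"
  shows "\<exists>c. snd.ev [:- \<theta>s (d - Suc i), 1:] (fst.ev (eta_poly d \<theta> (Suc i)) \<xi>)
    = c *s fst.ev (eta_poly d \<theta> i) \<xi>"
proof -
  interpret r: leonard_operators scale d "\<lambda>i. e (d - i)" "\<lambda>i. \<theta> (d - i)" f \<theta>s
    by (rule leonard_operators_reverse_first)
  interpret r: leonard_operators scale d "\<lambda>i. e (d - i)" "\<lambda>i. \<theta> (d - i)"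
    "\<lambda>i. f (d - i)" "\<lambda>i. \<theta>s (d - i)"
    by (rule r.leonard_operators_reverse_second)
  show ?thesis
    using r.split_lower[unfolded fst.ev_reverse snd.ev_reverse, folded eta_poly_eq_tau_poly, of \<xi> i]
      \<xi> i by auto
qed

lemma eta_parameters:
  assumes \<xi>: "f 0 \<xi> = \<xi>" "\<xi> \<noteq> 0"
    and T: "\<And>i. i \<le> d \<Longrightarrow> f 0 (fst.ev (eta_poly d \<theta> i) \<xi>) = T i *s \<xi>"
    and \<phi>: "\<And>i. 1 \<le> i \<Longrightarrow> i \<le> d \<Longrightarrow> \<phi> i = (\<theta>s 0 - \<theta>s i) * (T i / T (i - 1))"
  shows "T d \<noteq> 0" and "(\<Prod>h=1..d. \<phi> h) = poly (eta_poly d \<theta>s d) (\<theta>s 0) * T d"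
proof -
  interpret r: leonard_operators scale d "\<lambda>i. e (d - i)" "\<lambda>i. \<theta> (d - i)" f \<theta>s
    by (rule leonard_operators_reverse_first)
  note sp = r.split_parameters[unfolded fst.ev_reverse, folded eta_poly_eq_tau_poly, OF \<xi> T \<phi>]
  show "T d \<noteq> 0" and "(\<Prod>h=1..d. \<phi> h) = poly (eta_poly d \<theta>s d) (\<theta>s 0) * T d"
    using sp by auto
qed

section \<open>Two orthogonality relations\<close>

text \<open>
  The difference of the two polynomials is zero or of degree less than \<open>d\<close>, so it cannot connect \<open>f\<^sub>dV\<close> with
  \<open>f\<^sub>0V\<close>.
\<close>

lemma proj_0_monic:
  assumes p: "degree p = d" "lead_coeff p = 1" and q: "degree q = d" "lead_coeff q = 1"
    and \<xi>: "f d \<xi> = \<xi>"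
  shows "f 0 (fst.ev p \<xi>) = f 0 (fst.ev q \<xi>)"
proof -
  have "f 0 (fst.ev (p - q) (f d \<xi>)) = 0"
  proof (rule tri_poly)
    fix k assume "\<bar>int 0 - int d\<bar> \<le> int k"
    then show "coeff (p - q) k = 0"
      using p q by (cases "k = d") (auto simp: coeff_eq_0)
  qed auto
  then show ?thesis using \<xi> by (simp add: fst.ev_poly_diff snd.proj_diff)
qed

text \<open>
  The product \<open>\<tau>\<^sub>d\<^sub>-\<^sub>r \<eta>\<^sub>i\<close> has the roots \<open>\<theta>\<^sub>0, \<dots>, \<theta>\<^sub>d\<^sub>-\<^sub>r\<^sub>-\<^sub>1\<close> and \<open>\<theta>\<^sub>d\<^sub>-\<^sub>i\<^sub>+\<^sub>1, \<dots>, \<theta>\<^sub>d\<close>.  These are all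
  eigenvalues if \<open>r < i\<close>; if \<open>r > i\<close>, its degree \<open>d - r + i\<close> is too small to lead from \<open>f\<^sub>dV\<close> to \<open>f\<^sub>0V\<close>.
  The polynomial \<open>p\<close> is left open because \<open>\<tau>\<^sub>d\<close> and \<open>\<eta>\<^sub>d\<close> are both needed in its place.
\<close>

lemma tau_eta_orthogonal:
  assumes \<xi>: "f d \<xi> = \<xi>" and ir: "i \<le> d" "r \<le> d" and p: "degree p = d" "lead_coeff p = 1"
  shows "f 0 (fst.ev (tau_poly \<theta> (d - r)) (fst.ev (eta_poly d \<theta> i) \<xi>))
    = (if r = i then f 0 (fst.ev p \<xi>) else 0)"
proof -
  let ?q = "tau_poly \<theta> (d - r) * eta_poly d \<theta> i"
  have deg: "degree ?q = d - r + i" by (simp add: degree_mult_eq)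
  have lc: "lead_coeff ?q = 1" by (simp only: lead_coeff_mult) simp
  consider "r = i" | "r < i" | "i < r" by linarith
  then have "f 0 (fst.ev ?q \<xi>) = (if r = i then f 0 (fst.ev p \<xi>) else 0)"
  proof cases
    case 1
    then show ?thesis using proj_0_monic[OF _ lc p \<xi>] deg ir by simp
  next
    case 2
    have "fst.ev ?q \<xi> = 0"
    proof (rule fst.ev_eqI)
      fix j assume j: "j \<le> d"
      have "poly ?q (\<theta> j) = 0"
      proof (cases "j < d - r")
        case False
        then have "\<exists>h<i. d - h = j" using j 2 ir by (intro exI[of _ "d - j"]) auto
        then show ?thesis by (auto simp: eta_poly_eq_tau_poly poly_tau_poly)
      qed (auto simp: poly_tau_poly)
      then show "poly ?q (\<theta> j) *s e j \<xi> = e j 0" using j by (simp add: fst.proj_0)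
    qed
    then show ?thesis using 2 by (simp add: snd.proj_0)
  next
    case 3
    have "f 0 (fst.ev ?q (f d \<xi>)) = 0"
      by (rule tri_poly) (use 3 ir deg in \<open>auto intro!: coeff_eq_0\<close>)
    then show ?thesis using 3 \<xi> by simp
  qed
  then show ?thesis by (simp add: fst.ev_mult)
qed

text \<open>
  Write \<open>w\<^sub>i = \<eta>\<^sub>i(a) \<xi>\<close>.  It lies in \<open>f\<^sub>d\<^sub>-\<^sub>iV + \<dots> + f\<^sub>dV\<close>, which \<open>\<eta>\<^sup>*\<^sub>r\<close> annihilates if \<open>r > i\<close>.  It also
  lies in \<open>e\<^sub>0V + \<dots> + e\<^sub>d\<^sub>-\<^sub>iV\<close>, from where \<open>r\<close> tridiagonal steps do not reach \<open>e\<^sub>dV\<close> if \<open>r < i\<close>.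
\<close>

lemma eta_dual_eta_orthogonal:
  assumes \<xi>: "f d \<xi> = \<xi>" "\<xi> \<noteq> 0" and ir: "i \<le> d" "r \<le> d"
    and \<psi>: "\<And>i. i < d \<Longrightarrow> snd.ev [:- \<theta>s (d - Suc i), 1:] (fst.ev (eta_poly d \<theta> (Suc i)) \<xi>)
      = \<phi> (d - i) *s fst.ev (eta_poly d \<theta> i) \<xi>"
  shows "e d (snd.ev (eta_poly d \<theta>s r) (fst.ev (eta_poly d \<theta> i) \<xi>))
    = (if r = i then (\<Prod>h<r. \<phi> (d - h)) *s e d \<xi> else 0)"
proof -
  define w where "w i = fst.ev (eta_poly d \<theta> i) \<xi>" for i
  note ev = eta_vector[OF \<xi>, folded w_def]
  have less: "snd.ev (eta_poly d \<theta>s r) (w i) = 0" if "i < r" "r \<le> d" for i r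
  proof (rule snd.ev_eqI)
    fix j assume j: "j \<le> d"
    show "poly (eta_poly d \<theta>s r) (\<theta>s j) *s f j (w i) = f j 0"
    proof (cases "j < d - i")
      case True
      then show ?thesis using ev(1)[of i j] that j by (simp add: snd.proj_0)
    next
      case False
      then have "\<exists>h<r. d - h = j" using j that by (intro exI[of _ "d - j"]) auto
      then have "poly (eta_poly d \<theta>s r) (\<theta>s j) = 0"
        by (auto simp: eta_poly_eq_tau_poly poly_tau_poly)
      then show ?thesis using j by (simp add: snd.proj_0)
    qed
  qed
  have greater: "e d (snd.ev (eta_poly d \<theta>s r) (w i)) = 0" if "r < i" "i \<le> d" for i r
  proof -
    have "e d (snd.ev (eta_poly d \<theta>s r) (e j (w i))) = 0" if j: "j \<le> d" for j
    proof (cases "d - i < j")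
      case True
      then show ?thesis using ev(2)[of i j] \<open>i \<le> d\<close> j by (simp add: snd.ev_0 fst.proj_0)
    next
      case False
      show ?thesis using False j \<open>r < i\<close> \<open>i \<le> d\<close>
        by (intro dual.tri_poly) (auto intro!: coeff_eq_0)
    qed
    then have "(\<Sum>j\<le>d. e d (snd.ev (eta_poly d \<theta>s r) (e j (w i)))) = 0" by simp
    then show ?thesis
      using snd.ev_distrib_sum[of "eta_poly d \<theta>s r" "\<lambda>j. e j (w i)" "{..d}"]
      by (simp add: fst.proj_sum flip: fst.proj_distrib_sum)
  qed
  have equal: "e d (snd.ev (eta_poly d \<theta>s r) (w r)) = (\<Prod>h<r. \<phi> (d - h)) *s e d \<xi>"
    if "r \<le> d" for r
    using that
  proof (induction r)
    case 0
    then show ?case by (simp add: w_def eta_poly_eq_tau_poly fst.ev_1 snd.ev_1)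
  next
    case (Suc r)
    have "eta_poly d \<theta>s (Suc r) = eta_poly d \<theta>s r * [:- \<theta>s (d - r), 1:]"
      by (simp only: eta_poly_eq_tau_poly tau_poly_Suc mult.commute)
    then have "snd.ev (eta_poly d \<theta>s (Suc r)) (w (Suc r)) =
      snd.ev (eta_poly d \<theta>s r) (snd.ev [:- \<theta>s (d - r), 1:] (w (Suc r)))"
      by (simp only: snd.ev_mult)
    \<comment> \<open>Exchanging the root makes the lowering relation applicable; the extra multiple of
      \<open>w\<^sub>r\<^sub>+\<^sub>1\<close> contributes nothing, since only \<open>r\<close> factors of \<open>\<eta>\<^sup>*\<close> remain.\<close>
    also have "snd.ev [:- \<theta>s (d - r), 1:] (w (Suc r)) = 
      snd.ev [:- \<theta>s (d - Suc r), 1:] (w (Suc r)) + (\<theta>s (d - Suc r) - \<theta>s (d - r)) *s w (Suc r)"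
      by (simp add: snd.ev_linear_factor fst.scale_left_diff_distrib)
    finally show ?case
      using Suc \<psi>[of r, folded w_def] greater[of r "Suc r"]
      by (simp add: snd.ev_add snd.ev_scale fst.proj_add fst.proj_scale mult.commute)
  qed
  consider "r = i" | "r < i" | "i < r" by linarith
  then show ?thesis
    using less[of i r] greater[of r i] equal[of r] ir unfolding w_def[symmetric]
    by cases (auto simp: fst.proj_0)
qed

end

section \<open>The bilinear form\<close>

text \<open>
  Since the projections are self-adjoint for the form, so is every polynomial in the operator, and
  distinct eigenspaces are orthogonal.
\<close>

locale spectral_form = spectral_decomposition scale d e \<theta>
  for scale :: "'k::field \<Rightarrow> 'v::ab_group_add \<Rightarrow> 'v" (infixr "*s" 75) and d e \<theta> +
  fixes B :: "'v \<Rightarrow> 'v \<Rightarrow> 'k"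
  assumes form_add_left: "B (u + v) w = B u w + B v w"
    and form_add_right: "B u (v + w) = B u v + B u w"
    and form_scale_left: "B (c *s u) v = c * B u v"
    and form_scale_right: "B u (c *s v) = c * B u v"
    and form_proj: "i \<le> d \<Longrightarrow> B (e i u) v = B u (e i v)"
begin

lemma form_0: "B 0 v = 0" "B u 0 = 0"
  using form_scale_left[of 0 0 v] form_scale_right[of u 0 0] by simp_all

lemma form_sum_left: "B (\<Sum>x\<in>S. g x) v = (\<Sum>x\<in>S. B (g x) v)"
  by (induction S rule: infinite_finite_induct) (simp_all add: form_0 form_add_left)

lemma form_sum_right: "B v (\<Sum>x\<in>S. g x) = (\<Sum>x\<in>S. B v (g x))"
  by (induction S rule: infinite_finite_induct) (simp_all add: form_0 form_add_right)

lemma form_ev: "B (ev p u) v = B u (ev p v)"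
  by (simp add: ev_def form_sum_left form_sum_right form_scale_left form_scale_right form_proj)

lemma form_orthogonal:
  assumes "\<And>i. i \<le> d \<Longrightarrow> e i u = 0 \<or> e i v = 0"
  shows "B u v = 0"
proof -
  have "B u v = (\<Sum>i\<le>d. B (e i u) v)" by (simp add: proj_sum flip: form_sum_left)
  also have "\<dots> = (\<Sum>i\<le>d. B (e i u) (e i v))"
    by (intro sum.cong refl) (simp add: form_proj proj_proj)
  also have "\<dots> = 0" using assms by (intro sum.neutral ballI) (metis atMost_iff form_0)
  finally show ?thesis .
qed

end

locale leonard_form =
  leonard_operators scale d e \<theta> f \<theta>s + fst: spectral_form scale d e \<theta> B + snd: spectral_form scale d f \<theta>s B
  for scale :: "'k::field \<Rightarrow> 'v::ab_group_add \<Rightarrow> 'v" (infixr "*s" 75) and d e \<theta> f \<theta>s B +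
  assumes form_nondegenerate: "(\<And>v. B u v = 0) \<Longrightarrow> u = 0"
begin

text \<open>
  \<open>\<langle>\<xi>, v\<rangle> = \<langle>\<xi>, e\<^sub>i v\<rangle>\<close> is a multiple of \<open>\<langle>\<xi>, \<xi>\<rangle>\<close> for every \<open>v\<close>, so \<open>\<langle>\<xi>, \<xi>\<rangle> = 0\<close> would put \<open>\<xi>\<close>
  into the radical.
\<close>

lemma form_self_nonzero:
  assumes "e i \<xi> = \<xi>" "\<xi> \<noteq> 0" "i \<le> d"
  shows "B \<xi> \<xi> \<noteq> 0"
proof
  assume *: "B \<xi> \<xi> = 0"
  have "B \<xi> v = 0" for v
  proof -
    obtain c where "e i v = c *s \<xi>" using fst.proj_line[of i \<xi> v] assms by auto
    then have "B \<xi> (e i v) = 0" using * by (simp add: fst.form_scale_right)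
    then show ?thesis using fst.form_proj[of i \<xi> v] assms by simp
  qed
  then show False using form_nondegenerate assms(2) by blast
qed

lemma proj_eq_form:
  assumes \<xi>: "e i \<xi> = \<xi>" "\<xi> \<noteq> 0" "i \<le> d"
  shows "e i v = (B \<xi> v / B \<xi> \<xi>) *s \<xi>"
proof -
  obtain c where c: "e i v = c *s \<xi>" using fst.proj_line[of i \<xi> v] assms by auto
  have "B \<xi> v = c * B \<xi> \<xi>"
    using fst.form_proj[of i \<xi> v] assms c by (simp add: fst.form_scale_right)
  then show ?thesis using c form_self_nonzero[OF \<xi>] by simp
qed

lemma proj_dual_nonzero:
  assumes y: "f d y = y" "y \<noteq> 0"
  shows "e 0 y \<noteq> 0" "e d y \<noteq> 0"
proof -
  have *: "snd.ev [:- \<theta>s d, 1:] y = 0"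
    using snd.ev_on_proj[of d y] y by simp
  show "e 0 y \<noteq> 0" using dual.eigenvector_proj_0[OF *] y by blast
  interpret r: leonard_operators scale d "\<lambda>i. e (d - i)" "\<lambda>i. \<theta> (d - i)" f \<theta>s
    by (rule leonard_operators_reverse_first)
  show "e d y \<noteq> 0" using r.dual.eigenvector_proj_0[OF *] y by auto
qed

lemma form_dual_nonzero:
  assumes "f d y = y" "y \<noteq> 0" "e i \<xi> = \<xi>" "\<xi> \<noteq> 0" "i = 0 \<or> i = d"
  shows "B \<xi> y \<noteq> 0"
  using proj_dual_nonzero[OF assms(1,2)] proj_eq_form[OF assms(3,4), of y] assms(5) by auto

text \<open>
  The scalars of the reversed split basis are the \<open>\<phi>\<^sub>i\<close> in reverse order.  With \<open>u\<^sub>k = \<tau>\<^sub>k(a) x\<close>,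
  \<open>w\<^sub>l = \<eta>\<^sub>l(a) y\<close>, and \<open>b\<close> the operator belonging to \<open>f\<close>, the supports in the two decompositions are
  disjoint enough to give \<open>\<langle>u\<^sub>k, w\<^sub>l\<rangle> = 0\<close> for \<open>k + l < d\<close> (by \<open>f\<close>) and for \<open>k + l > d\<close> (by \<open>e\<close>).
  Self-adjointness of \<open>a\<close> shows that \<open>\<langle>u\<^sub>k, w\<^sub>d\<^sub>-\<^sub>k\<rangle>\<close> is independent of \<open>k\<close>, and it is nonzero.
  Computing \<open>\<langle>b u\<^sub>k\<^sub>+\<^sub>1, w\<^sub>d\<^sub>-\<^sub>k\<rangle> = \<langle>u\<^sub>k\<^sub>+\<^sub>1, b w\<^sub>d\<^sub>-\<^sub>k\<rangle>\<close> in two ways then compares the two scalars.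
\<close>

lemma split_parameters_agree:
  assumes x: "f 0 x = x" "x \<noteq> 0" and y: "f d y = y" "y \<noteq> 0"
    and \<phi>: "\<And>i. i < d \<Longrightarrow> snd.ev [:- \<theta>s (Suc i), 1:] (fst.ev (tau_poly \<theta> (Suc i)) x)
            = \<phi> (Suc i) *s fst.ev (tau_poly \<theta> i) x"
    and i: "i < d"
  shows "snd.ev [:- \<theta>s (d - Suc i), 1:] (fst.ev (eta_poly d \<theta> (Suc i)) y)
      = \<phi> (d - i) *s fst.ev (eta_poly d \<theta> i) y"
proof -
  define u where "u k = fst.ev (tau_poly \<theta> k) x" for k
  define w where "w k = fst.ev (eta_poly d \<theta> k) y" for k
  note su = split_vector[OF x, folded u_def] and sw = eta_vector[OF y, folded w_def]
  have u_Suc: "u (Suc k) = fst.ev [:0, 1:] (u k) - \<theta> k *s u k" for k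
    unfolding u_def tau_poly_Suc fst.ev_mult by (rule fst.ev_linear_factor)
  have w_Suc: "w (Suc k) = fst.ev [:0, 1:] (w k) - \<theta> (d - k) *s w k" for k
    unfolding w_def eta_poly_eq_tau_poly tau_poly_Suc fst.ev_mult by (rule fst.ev_linear_factor)
  have orth: "B (u k) (w l) = 0" if "k \<le> d" "l \<le> d" "k + l \<noteq> d" for k l
  proof (cases "k + l < d")
    case True
    show ?thesis
    proof (rule snd.form_orthogonal)
      fix j assume "j \<le> d"
      then show "f j (u k) = 0 \<or> f j (w l) = 0"
        using True su(2)[of k j] sw(1)[of l j] that by (cases "k < j") auto
    qed
  next
    case False
    show ?thesis
    proof (rule fst.form_orthogonal)
      fix j assume "j \<le> d"
      then show "e j (u k) = 0 \<or> e j (w l) = 0"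
        using False su(3)[of k j] sw(2)[of l j] that by (cases "j < k") auto
    qed
  qed
  have form_diff: "B (a - b *s a') c = B a c - b * B a' c" "B c (a - b *s a') = B c a - b * B c a'"
    for a b a' c
    using fst.form_add_left[of "a - b *s a'" "b *s a'" c]
      fst.form_add_right[of c "a - b *s a'" "b *s a'"]
    by (simp_all add: fst.form_scale_left fst.form_scale_right)
  \<comment> \<open>Both sides equal \<open>\<langle>a u\<^sub>k, w\<^sub>d\<^sub>-\<^sub>k\<^sub>-\<^sub>1\<rangle>\<close>.\<close>
  have const: "B (u (Suc k)) (w (d - Suc k)) = B (u k) (w (d - k))" if k: "k < d" for k
  proof -
    have s: "d - k = Suc (d - Suc k)" using k by simp
    have "B (u (Suc k)) (w (d - Suc k)) = B (u k) (fst.ev [:0, 1:] (w (d - Suc k)))"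
      using orth[of k "d - Suc k"] k by (simp add: u_Suc form_diff fst.form_ev)
    also have "\<dots> = B (u k) (w (d - k))"
      using orth[of k "d - Suc k"] k by (simp add: s w_Suc form_diff)
    finally show ?thesis .
  qed
  have g: "B (u d) (w 0) = B (u k) (w (d - k))" if "k \<le> d" for k
    using that by (induction rule: inc_induct) (use const in auto)
  have "e d (u d) = u d"
  proof (rule fst.eq_by_proj)
    fix j assume "j \<le> d"
    then show "e j (e d (u d)) = e j (u d)"
      using su(3)[of d j] by (auto simp: fst.proj_proj)
  qed
  moreover have "u d \<noteq> 0" using su(1)[of d] by (auto simp: snd.proj_0)
  ultimately have "B (u d) y \<noteq> 0" using form_dual_nonzero[OF y] by blast
  then have g0: "B (u d) (w 0) \<noteq> 0" by (simp add: w_def eta_poly_eq_tau_poly fst.ev_1)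

  obtain c where c: "snd.ev [:- \<theta>s (d - Suc i), 1:] (w (Suc i)) = c *s w i"
    using eta_lower[OF y i] by (auto simp: w_def)
  \<comment> \<open>The index for which \<open>w\<^sub>i\<^sub>+\<^sub>1\<close> is paired with \<open>u\<^sub>k\<close>.  The eigenvalues in the linear factors can be
    changed at will, since \<open>\<langle>u\<^sub>k\<^sub>+\<^sub>1, w\<^sub>i\<^sub>+\<^sub>1\<rangle> = 0\<close>.\<close>
  define k where "k = d - Suc i"
  have k: "k < d" "d - i = Suc k" "d - k = Suc i" "d - Suc k = i" using i by (auto simp: k_def)
  have "\<phi> (Suc k) * B (u k) (w (Suc i)) = B (snd.ev [:- \<theta>s (Suc k), 1:] (u (Suc k))) (w (Suc i))"
    using \<phi>[of k] k by (simp add: u_def fst.form_scale_left)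
  also have "\<dots> = B (u (Suc k)) (snd.ev [:0, 1:] (w (Suc i)))"
    using orth[of "Suc k" "Suc i"] k i by (simp add: snd.ev_linear_factor form_diff snd.form_ev)
  also have "\<dots> = B (u (Suc k)) (snd.ev [:- \<theta>s k, 1:] (w (Suc i)))"
    using orth[of "Suc k" "Suc i"] k i by (simp add: snd.ev_linear_factor form_diff)
  also have "\<dots> = c * B (u (Suc k)) (w i)"
    using c by (simp add: k_def fst.form_scale_right)
  finally have "\<phi> (d - i) = c"
    using g[of k] g[of "Suc k"] g0 k by simp
  then show ?thesis using c by (simp add: w_def)
qed

text \<open>
  \<open>\<tau>\<^sub>d\<close> vanishes at all eigenvalues but \<open>\<theta>\<^sub>d\<close>, so its value at the operator is a multiple of \<open>e\<^sub>d\<close>.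
\<close>

lemma proj_0_tau_poly:
  assumes z: "e d z = z" "z \<noteq> 0"
  shows "f 0 (fst.ev (tau_poly \<theta> d) v) = (poly (tau_poly \<theta> d) (\<theta> d) / B z z * B z v) *s f 0 z"
proof -
  have "fst.ev (tau_poly \<theta> d) v = poly (tau_poly \<theta> d) (\<theta> d) *s e d v"
  proof (rule fst.ev_eqI)
    fix j assume "j \<le> d"
    then show "poly (tau_poly \<theta> d) (\<theta> j) *s e j v = e j (poly (tau_poly \<theta> d) (\<theta> d) *s e d v)"
      by (cases "j = d") (auto simp: fst.proj_scale fst.proj_proj poly_tau_poly)
  qed
  then show ?thesis by (simp add: proj_eq_form[OF z] snd.proj_scale)
qed

lemma form_pairing_nonzero:
  assumes x: "f 0 x = x" "x \<noteq> 0" and z: "e d z = z" "z \<noteq> 0"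
    and T: "f 0 (fst.ev (tau_poly \<theta> d) x) = T *s x" "T \<noteq> 0"
  shows "B z x \<noteq> 0"
  using T x proj_0_tau_poly[OF z, of x] by auto

text \<open>
  For \<open>r = i\<close> the polynomial may be replaced by \<open>\<tau>\<^sub>d\<close>, whose value factors through \<open>e\<^sub>d\<close>.  Hence the
  results for the starting vectors \<open>y\<close> and \<open>x\<close> are in the ratio \<open>\<langle>z, y\<rangle> : \<langle>z, x\<rangle>\<close>, and the one for \<open>x\<close> is
  known: \<open>T\<close> is the trace \<open>tr(\<tau>\<^sub>d(A) E\<^sup>*\<^sub>0)\<close>.
\<close>

lemma tau_eta_transition:
  assumes x: "f 0 x = x" "x \<noteq> 0" and y: "f d y = y" "y \<noteq> 0" and z: "e d z = z" "z \<noteq> 0"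
    and T: "f 0 (fst.ev (tau_poly \<theta> d) x) = T *s x" "T \<noteq> 0"
    and ir: "i \<le> d" "r \<le> d"
  shows "f 0 (fst.ev (tau_poly \<theta> (d - r)) (fst.ev (eta_poly d \<theta> i) y))
    = (if r = i then (T * (B z y / B z x)) *s x else 0)"
proof -
  have "B z x \<noteq> 0" by (rule form_pairing_nonzero[OF x z T])
  then have "f 0 (fst.ev (tau_poly \<theta> d) y) = (B z y / B z x) *s f 0 (fst.ev (tau_poly \<theta> d) x)"
    by (simp add: proj_0_tau_poly[OF z])
  then have "f 0 (fst.ev (tau_poly \<theta> d) y) = (T * (B z y / B z x)) *s x"
    using T by (simp add: mult.commute)
  then show ?thesis using tau_eta_orthogonal[OF y(1) ir, of "tau_poly \<theta> d"]
    by simp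
qed

text \<open>
  Here the polynomial is replaced by \<open>\<eta>\<^sub>d\<close>, whose value is a multiple \<open>K e\<^sub>0\<close>, and
  \<open>K e\<^sub>0 f\<^sub>0 z = T z\<close> for \<open>z\<close> in \<open>e\<^sub>0V\<close>, where \<open>T\<close> is the trace \<open>tr(\<eta>\<^sub>d(A) E\<^sup>*\<^sub>0)\<close>.
\<close>

lemma proj_tau_eta_transition:
  assumes x: "f 0 x = x" "x \<noteq> 0" and y: "f d y = y" "y \<noteq> 0" and z: "e 0 z = z" "z \<noteq> 0"
    and T: "f 0 (fst.ev (eta_poly d \<theta> d) x) = T *s x" "T \<noteq> 0"
    and ir: "i \<le> d" "r \<le> d"
  shows "e 0 (f 0 (fst.ev (tau_poly \<theta> (d - r)) (fst.ev (eta_poly d \<theta> i) y)))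
    = (if r = i then (T * (B z y / B z z)) *s z else 0)"
proof -
  define K where "K = poly (eta_poly d \<theta> d) (\<theta> 0)"
  have ev_eta: "fst.ev (eta_poly d \<theta> d) v = K *s e 0 v" for v
  proof (rule fst.ev_eqI)
    fix j assume j: "j \<le> d"
    show "poly (eta_poly d \<theta> d) (\<theta> j) *s e j v = e j (K *s e 0 v)"
    proof (cases "j = 0")
      case False
      then have "\<exists>h<d. d - h = j" using j by (intro exI[of _ "d - j"]) auto
      then show ?thesis using j False
        by (auto simp: fst.proj_scale fst.proj_proj eta_poly_eq_tau_poly poly_tau_poly)
    qed (auto simp: K_def fst.proj_scale fst.proj_proj)
  qed
  \<comment> \<open>The hypothesis on \<open>T\<close> concerns \<open>x\<close>; it is transferred to \<open>z\<close> through \<open>e\<^sub>0 x = c z\<close>.\<close>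
  define c where "c = B z x / B z z"
  have ex: "e 0 x = c *s z" using proj_eq_form[OF z] by (simp add: c_def)
  have "c \<noteq> 0" using T x ex by (auto simp: ev_eta snd.proj_0)
  have "(c * K) *s e 0 (f 0 z) = e 0 (f 0 (fst.ev (eta_poly d \<theta> d) x))"
    by (simp add: ev_eta ex fst.proj_scale snd.proj_scale mult.commute)
  also have "\<dots> = c *s T *s z" using T ex by (simp add: fst.proj_scale mult.commute)
  finally have "c *s (K *s e 0 (f 0 z)) = c *s (T *s z)" by simp
  then have K: "K *s e 0 (f 0 z) = T *s z" using \<open>c \<noteq> 0\<close> by (metis fst.scale_left_imp_eq)
  have "e 0 (f 0 (fst.ev (eta_poly d \<theta> d) y)) = (B z y / B z z) *s (K *s e 0 (f 0 z))"
    by (simp add: ev_eta proj_eq_form[OF z, of y] fst.proj_scale snd.proj_scale mult.commute)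
  then have "e 0 (f 0 (fst.ev (eta_poly d \<theta> d) y)) = (T * (B z y / B z z)) *s z"
    by (simp add: K mult.commute)
  then show ?thesis using tau_eta_orthogonal[OF y(1) ir, of "eta_poly d \<theta> d"]
    by (simp add: fst.proj_0)
qed

text \<open>
  By self-adjointness, \<open>f\<^sub>d e\<^sub>d y = 0\<close> would imply \<open>\<langle>e\<^sub>d y, y\<rangle> = 0\<close>.
\<close>

lemma proj_d_proj_d_nonzero:
  assumes y: "f d y = y" "y \<noteq> 0"
  shows "f d (e d y) \<noteq> 0"
proof
  assume "f d (e d y) = 0"
  then have "B (e d y) y = 0" using snd.form_proj[of d "e d y" y] y by (simp add: snd.form_0)
  moreover have "e d (e d y) = e d y" by (simp add: fst.proj_proj)
  ultimately show False
    using form_dual_nonzero[OF y, of d "e d y"] proj_dual_nonzero(2)[OF y] by blast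
qed

end

section \<open>Primitive idempotents of a full matrix algebra\<close>

text \<open>
  \<open>m Y\<close> is the matrix of \<open>Y\<close> with respect to a basis of eigenvectors of \<open>X\<close>.
\<close>

locale eigenbasis_coordinates = full_matrix_algebra sA d \<rho>
  for sA :: "'k::field \<Rightarrow> 'a::ring_1 \<Rightarrow> 'a" and d \<rho> +
  fixes X :: 'a and \<theta> :: "nat \<Rightarrow> 'k" and E :: "nat \<Rightarrow> 'a" and m :: "'a \<Rightarrow> nat \<Rightarrow> nat \<Rightarrow> 'k"
  assumes coord_inject: "(\<And>a b. a \<le> d \<Longrightarrow> b \<le> d \<Longrightarrow> m Y a b = m Z a b) \<Longrightarrow> Y = Z"
    and coord_mult: "a \<le> d \<Longrightarrow> b \<le> d \<Longrightarrow> m (Y * Z) a b = (\<Sum>c\<le>d. m Y a c * m Z c b)"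
    and coord_add: "a \<le> d \<Longrightarrow> b \<le> d \<Longrightarrow> m (Y + Z) a b = m Y a b + m Z a b"
    and coord_scale: "a \<le> d \<Longrightarrow> b \<le> d \<Longrightarrow> m (sA c Y) a b = c * m Y a b"
    and coord_1: "a \<le> d \<Longrightarrow> b \<le> d \<Longrightarrow> m 1 a b = (if a = b then 1 else 0)"
    and coord_trace: "alg_trace \<rho> Y = (\<Sum>a\<le>d. m Y a a)"
    and coord_idempotent:
      "i \<le> d \<Longrightarrow> a \<le> d \<Longrightarrow> b \<le> d \<Longrightarrow> m (E i) a b = (if a = i \<and> b = i then 1 else 0)"
    and coord_diagonal: "a \<le> d \<Longrightarrow> b \<le> d \<Longrightarrow> m X a b = (if a = b then \<theta> a else 0)"
begin

lemma coord_0: "a \<le> d \<Longrightarrow> b \<le> d \<Longrightarrow> m 0 a b = 0"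
  using coord_scale[of a b 0 0] by simp

lemma coord_sum:
  assumes "a \<le> d" "b \<le> d"
  shows "m (\<Sum>x\<in>S. g x) a b = (\<Sum>x\<in>S. m (g x) a b)"
  by (induction S rule: infinite_finite_induct) (use assms in \<open>simp_all add: coord_0 coord_add\<close>)

lemma coord_mult_idempotent:
  assumes "i \<le> d" "a \<le> d" "b \<le> d"
  shows "m (Y * E i) a b = (if b = i then m Y a i else 0)"
proof -
  have "m (Y * E i) a b = (\<Sum>c\<le>d. if c = i then (if b = i then m Y a i else 0) else 0)"
    using assms by (simp only: coord_mult, intro sum.cong) (auto simp: coord_idempotent)
  then show ?thesis using assms by simp
qed

lemma coord_idempotent_mult:
  assumes "i \<le> d" "a \<le> d" "b \<le> d"
  shows "m (E i * Y) a b = (if a = i then m Y i b else 0)"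
proof -
  have "m (E i * Y) a b = (\<Sum>c\<le>d. if c = i then (if a = i then m Y i b else 0) else 0)"
    using assms by (simp only: coord_mult, intro sum.cong) (auto simp: coord_idempotent)
  then show ?thesis using assms by simp
qed

lemma idempotents_orthogonal:
  assumes "i \<le> d" "j \<le> d"
  shows "E i * E j = (if i = j then E j else 0)"
  by (rule coord_inject) (use assms in \<open>auto simp: coord_mult_idempotent coord_idempotent coord_0\<close>)

lemma idempotents_sum: "(\<Sum>i\<le>d. E i) = 1"
proof (rule coord_inject)
  fix a b assume ab: "a \<le> d" "b \<le> d"
  have "m (\<Sum>i\<le>d. E i) a b = (\<Sum>i\<le>d. if i = a then (if a = b then 1 else 0) else 0)"
    using ab by (simp only: coord_sum, intro sum.cong) (auto simp: coord_idempotent)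
  then show "m (\<Sum>i\<le>d. E i) a b = m 1 a b" using ab by (simp add: coord_1)
qed

text \<open>
  Both sides are multiples of the diagonal matrix unit \<open>E i\<close>, and the trace of \<open>Y * E i\<close> is the
  \<open>i\<close>-th diagonal entry of \<open>Y\<close>.
\<close>

lemma idempotent_compress:
  assumes i: "i \<le> d"
  shows "E i * Y * E i = sA (alg_trace \<rho> (Y * E i)) (E i)"
proof -
  have "alg_trace \<rho> (Y * E i) = (\<Sum>a\<le>d. if a = i then m Y i i else 0)"
    unfolding coord_trace using i by (intro sum.cong) (auto simp: coord_mult_idempotent)
  then have "alg_trace \<rho> (Y * E i) = m Y i i" using i by simp
  then show ?thesis
    by (intro coord_inject)
      (use i in \<open>auto simp: coord_mult_idempotent coord_idempotent_mult coord_scale coord_idempotent\<close>)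
qed

lemma poly_at_idempotent:
  assumes i: "i \<le> d"
  shows "poly_at sA p X * E i = sA (poly p (\<theta> i)) (E i)"
proof -
  have "X * E i = sA (\<theta> i) (E i)"
    by (rule coord_inject)
      (use i in \<open>auto simp: coord_mult_idempotent coord_scale coord_idempotent coord_diagonal\<close>)
  then have "X ^ k * E i = sA (\<theta> i ^ k) (E i)" for k
    by (induction k) (simp_all add: mult.assoc sA_mult_right mult.commute)
  then show ?thesis
    by (simp add: poly_at_def poly_altdef sum_distrib_right sA_mult_left scale_sum_left)
qed

end

context full_matrix_algebra
begin

lemma rho_carrier [simp]: "\<rho> Y \<in> carrier_mat (Suc d) (Suc d)"
  using iso_bij by (auto simp: bij_betw_def)

lemma rho_dim [simp]: "dim_row (\<rho> Y) = Suc d" "dim_col (\<rho> Y) = Suc d"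
  using carrier_matD[OF rho_carrier[of Y]] by simp_all

lemma rho_inject: "\<rho> Y = \<rho> Z \<Longrightarrow> Y = Z"
  using iso_bij by (auto simp: bij_betw_def inj_def)

lemma rho_surj: assumes "M \<in> carrier_mat (Suc d) (Suc d)" obtains Y where "\<rho> Y = M"
proof -
  have "M \<in> range \<rho>" using assms iso_bij by (simp add: bij_betw_def)
  then show ?thesis using that by blast
qed

lemma rho_diff_scale: "\<rho> (Y - sA t 1) = \<rho> Y - t \<cdot>\<^sub>m 1\<^sub>m (Suc d)"
proof -
  have "\<rho> Y = \<rho> (Y - sA t 1) + t \<cdot>\<^sub>m 1\<^sub>m (Suc d)"
    using iso_add[of "Y - sA t 1" "sA t 1"] by (simp add: iso_scale iso_one)
  then show ?thesis by (intro eq_matI) auto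
qed

lemma rho_zero: "\<rho> 0 = 0\<^sub>m (Suc d) (Suc d)"
proof -
  have "\<rho> 0 = 0 \<cdot>\<^sub>m \<rho> 0" using iso_scale[of 0 0] by (simp only: scale_zero_left)
  also have "\<dots> = 0\<^sub>m (Suc d) (Suc d)" by (intro eq_matI) auto
  finally show ?thesis .
qed

lemma mat_mult_index:
  assumes "M \<in> carrier_mat (Suc d) (Suc d)" "N \<in> carrier_mat (Suc d) (Suc d)" "a \<le> d" "b \<le> d"
  shows "(M * N) $$ (a, b) = (\<Sum>c\<le>d. M $$ (a, c) * N $$ (c, b))"
  using assms by (auto simp: scalar_prod_def atLeast0LessThan lessThan_Suc_atMost intro!: sum.cong)

text \<open>
  The scalar is the Lagrange basis polynomial of \<open>\<theta> i\<close> evaluated at the eigenvalue \<open>t\<close>.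
\<close>

lemma primitive_idempotent_eigenvector:
  assumes v: "v \<in> carrier_vec (Suc d)" "\<rho> X *\<^sub>v v = t \<cdot>\<^sub>v v"
  shows "\<rho> (primitive_idempotent sA d X \<theta> i) *\<^sub>v v =
    (\<Prod>j\<leftarrow>filter (\<lambda>j. j \<noteq> i) [0..<Suc d]. (t - \<theta> j) / (\<theta> i - \<theta> j)) \<cdot>\<^sub>v v"
proof -
  have factor: "\<rho> (sA c (X - sA s 1)) *\<^sub>v v = (c * (t - s)) \<cdot>\<^sub>v v" for c s
  proof -
    have 1: "(s \<cdot>\<^sub>m 1\<^sub>m (Suc d)) *\<^sub>v v = s \<cdot>\<^sub>v v"
      using v by (intro eq_vecI) auto
    have "\<rho> (X - sA s 1) *\<^sub>v v = t \<cdot>\<^sub>v v - s \<cdot>\<^sub>v v"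
      using v 1 by (subst rho_diff_scale, subst minus_mult_distrib_mat_vec[of _ "Suc d" "Suc d"]) auto
    also have "\<dots> = (t - s) \<cdot>\<^sub>v v" using v by (intro eq_vecI) (auto simp: algebra_simps)
    finally have 2: "\<rho> (X - sA s 1) *\<^sub>v v = (t - s) \<cdot>\<^sub>v v" .
    have "(c \<cdot>\<^sub>m \<rho> (X - sA s 1)) *\<^sub>v v = c \<cdot>\<^sub>v (\<rho> (X - sA s 1) *\<^sub>v v)"
      using v by (intro eq_vecI) auto
    then show ?thesis using 2 by (simp add: iso_scale smult_smult_assoc)
  qed
  have "\<rho> (\<Prod>j\<leftarrow>js. sA (1 / (\<theta> i - \<theta> j)) (X - sA (\<theta> j) 1)) *\<^sub>v v =
    (\<Prod>j\<leftarrow>js. (t - \<theta> j) / (\<theta> i - \<theta> j)) \<cdot>\<^sub>v v" for js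
  proof (induction js)
    case (Cons j js)
    have "\<rho> (\<Prod>j\<leftarrow>j # js. sA (1 / (\<theta> i - \<theta> j)) (X - sA (\<theta> j) 1)) *\<^sub>v v =
      \<rho> (sA (1 / (\<theta> i - \<theta> j)) (X - sA (\<theta> j) 1)) *\<^sub>v
        (\<rho> (\<Prod>j\<leftarrow>js. sA (1 / (\<theta> i - \<theta> j)) (X - sA (\<theta> j) 1)) *\<^sub>v v)"
      using v by (simp add: iso_mult) (rule assoc_mult_mat_vec[of _ "Suc d" "Suc d" _ "Suc d"], auto)
    also have "\<dots> = (\<Prod>j\<leftarrow>js. (t - \<theta> j) / (\<theta> i - \<theta> j)) \<cdot>\<^sub>v
        (\<rho> (sA (1 / (\<theta> i - \<theta> j)) (X - sA (\<theta> j) 1)) *\<^sub>v v)"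
      using v Cons by (simp add: mult_mat_vec[of _ "Suc d" "Suc d"])
    finally show ?case
      by (simp add: factor smult_smult_assoc mult.commute)
  qed (use v in \<open>simp add: iso_one\<close>)
  then show ?thesis by (simp only: primitive_idempotent_def)
qed

text \<open>
  Let \<open>P\<close> have eigenvectors \<open>v\<^sub>0, \<dots>, v\<^sub>d\<close> as columns.  Since \<open>E\<^sub>i v\<^sub>j\<close> is \<open>v\<^sub>i\<close> for \<open>i = j\<close> and \<open>0\<close>
  otherwise, applying \<open>E\<^sub>i\<close> to a linear relation between the columns isolates its \<open>i\<close>-th coefficient.
  So \<open>P\<close> is invertible, and conjugation by it gives the coordinates.
\<close>

lemma eigenbasis_coordinates_exist:
  assumes ord: "idempotent_ordering sA d \<rho> X \<theta> E"
  shows "\<exists>m. eigenbasis_coordinates sA d \<rho> X \<theta> E m"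
proof -
  let ?n = "Suc d"
  have bij: "bij_betw \<theta> {..d} {t. eigenvalue (\<rho> X) t}"
    and E: "\<And>i. i \<le> d \<Longrightarrow> E i = primitive_idempotent sA d X \<theta> i"
    using ord by (auto simp: idempotent_ordering_def)
  have inj: "\<theta> i = \<theta> j \<longleftrightarrow> i = j" if "i \<le> d" "j \<le> d" for i j
    using bij that by (auto simp: bij_betw_def inj_on_def)
  have "\<forall>j. \<exists>v. j \<le> d \<longrightarrow> eigenvector (\<rho> X) v (\<theta> j)"
    using bij by (auto simp: bij_betw_def eigenvalue_def)
  then obtain v where v: "\<And>j. j \<le> d \<Longrightarrow> eigenvector (\<rho> X) (v j) (\<theta> j)" by metis
  have vc: "v j \<in> carrier_vec ?n" "v j \<noteq> 0\<^sub>v ?n" "\<rho> X *\<^sub>v v j = \<theta> j \<cdot>\<^sub>v v j" if "j \<le> d" for j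
    using v[OF that] by (auto simp: eigenvector_def)
  have Ev: "\<rho> (E i) *\<^sub>v v j = (if i = j then 1 else 0) \<cdot>\<^sub>v v j" if ij: "i \<le> d" "j \<le> d" for i j
  proof -
    have "(\<Prod>k\<leftarrow>filter (\<lambda>k. k \<noteq> i) [0..<?n]. (\<theta> j - \<theta> k) / (\<theta> i - \<theta> k))
        = (if i = j then 1 else 0)"
    proof (cases "i = j")
      case True
      have "(\<Prod>k\<leftarrow>ks. (\<theta> j - \<theta> k) / (\<theta> i - \<theta> k)) = 1" if "\<forall>k\<in>set ks. k \<le> d \<and> k \<noteq> i" for ks
        using that ij inj True by (induction ks) auto
      then show ?thesis using True by (auto simp del: upt_Suc)
    next
      case False
      then have "0 \<in> set (map (\<lambda>k. (\<theta> j - \<theta> k) / (\<theta> i - \<theta> k)) (filter (\<lambda>k. k \<noteq> i) [0..<?n]))"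
        using ij by (auto simp: image_iff simp del: upt_Suc intro!: exI[of _ j])
      then show ?thesis using False by (simp only: prod_list_zero_iff if_False)
    qed
    then show ?thesis
      using primitive_idempotent_eigenvector[of "v j" X "\<theta> j" \<theta> i] vc ij E by simp
  qed
  define P where "P = mat ?n ?n (\<lambda>(a, b). v b $ a)"
  have P: "P \<in> carrier_mat ?n ?n" by (simp add: P_def)
  have colP: "col P j = v j" if "j \<le> d" for j
    using vc(1)[OF that] that by (intro eq_vecI) (auto simp: P_def)
  have mulP: "(\<rho> Y * P) $$ (a, b) = (\<rho> Y *\<^sub>v v b) $ a" if "a \<le> d" "b \<le> d" for Y a b
    using that P colP by auto
  have EP: "(\<rho> (E i) * P) $$ (a, b) = (if b = i then P $$ (a, i) else 0)"
    if "i \<le> d" "a \<le> d" "b \<le> d" for i a b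
    using that Ev[of i b] vc(1)[of b] mulP[of a b "E i"] by (auto simp: P_def)
  have XP: "(\<rho> X * P) $$ (a, b) = \<theta> b * P $$ (a, b)" if "a \<le> d" "b \<le> d" for a b
    using that vc[of b] mulP[of a b X] by (auto simp: P_def)
  have "det P \<noteq> 0"
  proof
    assume "det P = 0"
    then obtain x where x: "x \<in> carrier_vec ?n" "x \<noteq> 0\<^sub>v ?n" "P *\<^sub>v x = 0\<^sub>v ?n"
      using det_0_iff_vec_prod_zero_field[OF P] by auto
    have "x $ i = 0" if i: "i \<le> d" for i
    proof -
      have z: "(\<rho> (E i) * P) *\<^sub>v x = 0\<^sub>v ?n"
      proof -
        have "(\<rho> (E i) * P) *\<^sub>v x = \<rho> (E i) *\<^sub>v (P *\<^sub>v x)"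
          using P x by (intro assoc_mult_mat_vec[of _ ?n ?n _ ?n]) auto
        then show ?thesis using x by (auto intro!: eq_vecI)
      qed
      have "v i $ a * x $ i = 0" if a: "a \<le> d" for a
      proof -
        have "0 = ((\<rho> (E i) * P) *\<^sub>v x) $ a" using z a by simp
        also have "\<dots> = (\<Sum>b\<le>d. (\<rho> (E i) * P) $$ (a, b) * x $ b)"
          using a P x by (simp del: index_mult_mat(1)
            add: scalar_prod_def atLeast0LessThan lessThan_Suc_atMost)
        also have "\<dots> = (\<Sum>b\<le>d. if b = i then P $$ (a, i) * x $ b else 0)"
          using EP i a by (intro sum.cong) auto
        also have "\<dots> = v i $ a * x $ i" using i a by (simp add: P_def)
        finally show ?thesis by simp
      qed
      moreover obtain a where "a \<le> d" "v i $ a \<noteq> 0"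
      proof (rule ccontr)
        assume "\<not> thesis"
        then have "v i = 0\<^sub>v ?n" using vc(1)[OF i] that by (intro eq_vecI) (auto simp: less_Suc_eq_le)
        then show False using vc(2)[OF i] by simp
      qed
      ultimately show ?thesis by force
    qed
    then have "x = 0\<^sub>v ?n" using x(1) by (intro eq_vecI) auto
    then show False using x by simp
  qed
  from det_non_zero_imp_unit[OF P this, unfolded Units_def, of "()"]
  obtain Q where Q: "Q \<in> carrier_mat ?n ?n" and QP: "Q * P = 1\<^sub>m ?n" and PQ: "P * Q = 1\<^sub>m ?n"
    by (auto simp: ring_mat_def)
  define \<sigma> where "\<sigma> Y = Q * (\<rho> Y * P)" for Y
  have \<sigma>: "\<sigma> Y \<in> carrier_mat ?n ?n" for Y using P Q by (auto simp: \<sigma>_def intro!: mult_carrier_mat)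
  have \<rho>\<sigma>: "\<rho> Y = P * \<sigma> Y * Q" for Y
  proof -
    have "P * \<sigma> Y * Q = (P * Q) * \<rho> Y * (P * Q)"
      using P Q rho_carrier[of Y]
      by (simp add: \<sigma>_def assoc_mult_mat[of _ ?n ?n _ ?n _ ?n] mult_carrier_mat[of _ ?n ?n _ ?n])
    then show ?thesis by (simp add: PQ left_mult_one_mat[of _ ?n ?n] right_mult_one_mat[of _ ?n ?n])
  qed
  have \<sigma>_mult: "\<sigma> (Y * Z) = \<sigma> Y * \<sigma> Z" for Y Z
  proof -
    have "\<sigma> Y * \<sigma> Z = Q * (\<rho> Y * ((P * Q) * (\<rho> Z * P)))"
      using P Q rho_carrier[of Y] rho_carrier[of Z]
      by (simp add: \<sigma>_def assoc_mult_mat[of _ ?n ?n _ ?n _ ?n] mult_carrier_mat[of _ ?n ?n _ ?n])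
    then show ?thesis using P Q rho_carrier[of Y] rho_carrier[of Z]
      by (simp add: \<sigma>_def PQ iso_mult assoc_mult_mat[of _ ?n ?n _ ?n _ ?n] mult_carrier_mat[of _ ?n ?n _ ?n]
          left_mult_one_mat[of _ ?n ?n])
  qed
  have \<sigma>_index: "\<sigma> Y $$ (a, b) = (\<Sum>c\<le>d. Q $$ (a, c) * (\<rho> Y * P) $$ (c, b))"
    if "a \<le> d" "b \<le> d" for Y a b
    unfolding \<sigma>_def using P Q that by (intro mat_mult_index mult_carrier_mat[of _ ?n ?n]) auto
  have \<rho>P_index: "(\<rho> Y * P) $$ (a, b) = (\<Sum>c\<le>d. \<rho> Y $$ (a, c) * P $$ (c, b))"
    if "a \<le> d" "b \<le> d" for Y a b
    using P that by (intro mat_mult_index) auto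
  have QP_index: "(\<Sum>c\<le>d. Q $$ (a, c) * P $$ (c, b)) = (if a = b then 1 else 0)"
    if "a \<le> d" "b \<le> d" for a b
    using mat_mult_index[OF Q P that] QP that by simp
  have PQ_index: "(\<Sum>c\<le>d. P $$ (a, c) * Q $$ (c, b)) = (if a = b then 1 else 0)"
    if "a \<le> d" "b \<le> d" for a b
    using mat_mult_index[OF P Q that] PQ that by simp
  have "eigenbasis_coordinates sA d \<rho> X \<theta> E (\<lambda>Y a b. \<sigma> Y $$ (a, b))"
  proof
    fix Y Z assume "\<And>a b. a \<le> d \<Longrightarrow> b \<le> d \<Longrightarrow> \<sigma> Y $$ (a, b) = \<sigma> Z $$ (a, b)"
    then have "\<sigma> Y = \<sigma> Z" using \<sigma>[of Y] \<sigma>[of Z] by (intro eq_matI) auto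
    then show "Y = Z" using \<rho>\<sigma>[of Y] \<rho>\<sigma>[of Z] rho_inject by simp
  next
    fix Y Z a b assume ab: "a \<le> d" "b \<le> d"
    show "\<sigma> (Y * Z) $$ (a, b) = (\<Sum>c\<le>d. \<sigma> Y $$ (a, c) * \<sigma> Z $$ (c, b))"
      using mat_mult_index[OF \<sigma> \<sigma> ab] by (simp add: \<sigma>_mult)
    have "\<rho> (Y + Z) $$ (a, c) = \<rho> Y $$ (a, c) + \<rho> Z $$ (a, c)" if "a \<le> d" "c \<le> d" for a c
      using that by (simp add: iso_add)
    then show "\<sigma> (Y + Z) $$ (a, b) = \<sigma> Y $$ (a, b) + \<sigma> Z $$ (a, b)"
      using ab by (simp add: \<sigma>_index \<rho>P_index distrib_left distrib_right sum.distrib)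
  next
    fix c Y a b assume ab: "a \<le> d" "b \<le> d"
    have "\<rho> (sA c Y) $$ (a, k) = c * \<rho> Y $$ (a, k)" if "a \<le> d" "k \<le> d" for a k
      using that by (simp add: iso_scale)
    then show "\<sigma> (sA c Y) $$ (a, b) = c * \<sigma> Y $$ (a, b)"
      using ab by (simp add: \<sigma>_index \<rho>P_index sum_distrib_left mult.left_commute mult.assoc)
  next
    fix a b assume ab: "a \<le> d" "b \<le> d"
    show "\<sigma> 1 $$ (a, b) = (if a = b then 1 else 0)"
      using ab P QP by (simp add: \<sigma>_def iso_one left_mult_one_mat[of _ ?n ?n])
    show "\<sigma> X $$ (a, b) = (if a = b then \<theta> a else 0)"
      using ab QP_index[OF ab] by (simp add: \<sigma>_index XP mult.left_commute flip: sum_distrib_left)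
    fix i assume i: "i \<le> d"
    show "\<sigma> (E i) $$ (a, b) = (if a = i \<and> b = i then 1 else 0)"
      using ab i QP_index[of a i] by (cases "b = i") (simp_all add: \<sigma>_index EP)
  next
    fix Y
    have "(\<Sum>a\<le>d. \<sigma> Y $$ (a, a)) = (\<Sum>a\<le>d. \<Sum>c\<le>d. \<Sum>k\<le>d. Q $$ (a, c) * (\<rho> Y $$ (c, k) * P $$ (k, a)))"
      by (simp add: \<sigma>_index \<rho>P_index sum_distrib_left)
    also have "\<dots> = (\<Sum>c\<le>d. \<Sum>k\<le>d. \<Sum>a\<le>d. \<rho> Y $$ (c, k) * (P $$ (k, a) * Q $$ (a, c)))"
      by (subst sum.swap, rule sum.cong[OF refl], subst sum.swap) (simp add: ac_simps)
    also have "\<dots> = (\<Sum>c\<le>d. \<Sum>k\<le>d. \<rho> Y $$ (c, k) * (if k = c then 1 else 0))"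
      by (intro sum.cong refl) (simp add: PQ_index flip: sum_distrib_left)
    also have "\<dots> = (\<Sum>c\<le>d. \<rho> Y $$ (c, c))"
      by (intro sum.cong refl) (simp add: if_distrib cong: if_cong)
    finally show "alg_trace \<rho> Y = (\<Sum>a\<le>d. \<sigma> Y $$ (a, a))"
      by (simp add: alg_trace_def lessThan_Suc_atMost)
  qed
  then show ?thesis by blast
qed

lemma primitive_idempotents:
  assumes ord: "idempotent_ordering sA d \<rho> X \<theta> E"
  shows "\<And>i j. i \<le> d \<Longrightarrow> j \<le> d \<Longrightarrow> E i * E j = (if i = j then E j else 0)"
    and "(\<Sum>i\<le>d. E i) = 1"
    and "\<And>i p. i \<le> d \<Longrightarrow> poly_at sA p X * E i = sA (poly p (\<theta> i)) (E i)"
    and "\<And>i Y. i \<le> d \<Longrightarrow> E i * Y * E i = sA (alg_trace \<rho> (Y * E i)) (E i)"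
proof -
  obtain m where "eigenbasis_coordinates sA d \<rho> X \<theta> E m"
    using eigenbasis_coordinates_exist[OF ord] by blast
  then interpret eigenbasis_coordinates sA d \<rho> X \<theta> E m .
  show "\<And>i j. i \<le> d \<Longrightarrow> j \<le> d \<Longrightarrow> E i * E j = (if i = j then E j else 0)"
    and "(\<Sum>i\<le>d. E i) = 1"
    and "\<And>i p. i \<le> d \<Longrightarrow> poly_at sA p X * E i = sA (poly p (\<theta> i)) (E i)"
    and "\<And>i Y. i \<le> d \<Longrightarrow> E i * Y * E i = sA (alg_trace \<rho> (Y * E i)) (E i)"
    by (fact idempotents_orthogonal idempotents_sum poly_at_idempotent idempotent_compress)+
qed

text \<open>
  The polynomial is the Lagrange basis polynomial.  Being a polynomial in \<open>X\<close>, the idempotent is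
  fixed by every antiautomorphism that fixes \<open>X\<close>.
\<close>

lemma primitive_idempotent_poly_at:
  assumes ord: "idempotent_ordering sA d \<rho> X \<theta> E" and i: "i \<le> d"
  obtains p where "E i = poly_at sA p X"
proof -
  define p where "p = (\<Prod>j\<in>{..d} - {i}. Polynomial.smult (1 / (\<theta> i - \<theta> j)) [:- \<theta> j, 1:])"
  have inj: "\<theta> i \<noteq> \<theta> j" if "j \<le> d" "j \<noteq> i" for j
    using ord that i by (auto simp: idempotent_ordering_def bij_betw_def inj_on_def)
  have val: "poly p (\<theta> j) = (if j = i then 1 else 0)" if "j \<le> d" for j
  proof (cases "j = i")
    case True
    then show ?thesis unfolding p_def poly_prod
      using inj by (auto intro!: prod.neutral simp flip: diff_divide_distrib)
  next
    case False
    then show ?thesis using that unfolding p_def poly_prod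
      by (auto intro!: prod_zero bexI[of _ j])
  qed
  have "poly_at sA p X = poly_at sA p X * (\<Sum>j\<le>d. E j)"
    by (simp add: primitive_idempotents(2)[OF ord])
  also have "\<dots> = (\<Sum>j\<le>d. if j = i then E j else 0)"
    unfolding sum_distrib_left
    by (intro sum.cong refl) (auto simp: primitive_idempotents(3)[OF ord] val)
  also have "\<dots> = E i" using i by simp
  finally show ?thesis using that by metis
qed

lemma antiautomorphism_poly_at:
  assumes "antiautomorphism sA dag" "dag X = X"
  shows "dag (poly_at sA p X) = poly_at sA p X"
proof -
  have lin: "Vector_Spaces.linear sA sA dag" and bij: "bij dag"
    and mult: "\<And>Y Z. dag (Y * Z) = dag Z * dag Y"
    using assms by (auto simp: antiautomorphism_def)
  interpret dag: Vector_Spaces.linear sA sA dag by (rule lin)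
  obtain Y where "dag Y = 1" using bij by (metis bij_pointE)
  then have one: "dag 1 = 1" using mult[of Y 1] by simp
  have "dag (X ^ k) = X ^ k" for k
    by (induction k) (simp_all add: one mult assms(2) power_commutes)
  then show ?thesis by (simp add: poly_at_def dag.sum dag.scale)
qed

end

section \<open>The irreducible module\<close>

locale matrix_algebra_module =
  alg: full_matrix_algebra sA d \<rho> + mod: irreducible_left_module sA sV act
  for sA :: "'k::field \<Rightarrow> 'a::ring_1 \<Rightarrow> 'a" and d \<rho>
    and sV :: "'k \<Rightarrow> 'v::ab_group_add \<Rightarrow> 'v" and act
begin

lemma act_scale_left: "act (sA c Y) v = sV c (act Y v)"
  using mod.act_mult[of "sA c 1" Y v] by (simp add: alg.sA_mult_left mod.act_scale)

lemma act_scale_right: "act Y (sV c v) = sV c (act Y v)"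
  using mod.act_mult[of Y "sA c 1" v]
  by (simp add: alg.sA_mult_right mod.act_scale act_scale_left mod.act_one)

lemma act_zero_left: "act 0 v = 0"
  using mod.act_add_left[of 0 0 v] by simp

lemma act_zero_right: "act Y 0 = 0"
  using mod.act_add_right[of Y 0 0] by simp

lemma act_sum: "act (\<Sum>x\<in>S. g x) v = (\<Sum>x\<in>S. act (g x) v)"
  by (induction S rule: infinite_finite_induct) (simp_all add: act_zero_left mod.act_add_left)

lemma orbit_UNIV: assumes "v \<noteq> 0" obtains Y where "act Y v = w"
proof -
  have "range (\<lambda>Y. act Y v) = {0} \<or> range (\<lambda>Y. act Y v) = UNIV"
  proof (rule mod.irreducible)
    show "0 \<in> range (\<lambda>Y. act Y v)" using act_zero_left[of v] by (metis rangeI)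
    show "x - y \<in> range (\<lambda>Y. act Y v)"
      if xy: "x \<in> range (\<lambda>Y. act Y v)" "y \<in> range (\<lambda>Y. act Y v)" for x y
    proof -
      obtain Y Z where "x = act Y v" "y = act Z v" using xy by blast
      then have "act (Y - Z) v = x - y" using mod.act_add_left[of "Y - Z" Z v] by simp
      then show ?thesis by (metis rangeI)
    qed
    show "act X x \<in> range (\<lambda>Y. act Y v)" if "x \<in> range (\<lambda>Y. act Y v)" for X x
      using that by (auto simp flip: mod.act_mult)
  qed
  moreover have "v \<in> range (\<lambda>Y. act Y v)" using mod.act_one[of v] by (metis rangeI)
  ultimately have "range (\<lambda>Y. act Y v) = UNIV" using assms by auto
  then show ?thesis using that by (metis UNIV_I imageE)
qed

text \<open>
  If \<open>Y\<close> has a nonzero entry at \<open>(p, q)\<close> and \<open>U k l\<close> are the matrix units, then \<open>U k p * Y * U q k\<close> is a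
  nonzero multiple of \<open>U k k\<close>.  So if \<open>Y\<close> acts as zero, then so does \<open>1\<close>, the sum of all \<open>U k k\<close>.
\<close>

lemma faithful:
  assumes "Y \<noteq> 0" obtains v where "act Y v \<noteq> 0"
proof (rule ccontr)
  assume no: "\<not> thesis"
  have Y0: "act Y v = 0" for v using no that by blast
  have "\<rho> Y \<noteq> 0\<^sub>m (Suc d) (Suc d)"
  proof
    assume *: "\<rho> Y = 0\<^sub>m (Suc d) (Suc d)"
    then show False using alg.rho_zero alg.rho_inject[of Y 0] assms by simp
  qed
  then obtain p q where pq: "p \<le> d" "q \<le> d" "\<rho> Y $$ (p, q) \<noteq> 0"
    using alg.rho_dim by (metis (no_types, lifting) eq_matI index_zero_mat less_Suc_eq_le)
  define U where "U k l = (SOME Z. \<rho> Z = mat (Suc d) (Suc d) (\<lambda>(a, b). if a = k \<and> b = l then 1 else 0))" for k l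
  have U: "\<rho> (U k l) = mat (Suc d) (Suc d) (\<lambda>(a, b). if a = k \<and> b = l then 1 else 0)" for k l
    unfolding U_def by (rule someI_ex) (metis alg.rho_surj mat_carrier)
  have U_index: "\<rho> (U k l) $$ (a, b) = (if a = k \<and> b = l then 1 else 0)" if "a \<le> d" "b \<le> d" for k l a b
    using that by (simp add: U)
  have mult: "\<rho> (Z * Z') $$ (a, b) = (\<Sum>c\<le>d. \<rho> Z $$ (a, c) * \<rho> Z' $$ (c, b))"
    if "a \<le> d" "b \<le> d" for Z Z' a b
    using alg.mat_mult_index[OF alg.rho_carrier alg.rho_carrier that] by (simp add: alg.iso_mult)
  have YU: "\<rho> (Y * U q k) $$ (a, b) = (if b = k then \<rho> Y $$ (a, q) else 0)"
    if "a \<le> d" "b \<le> d" for k a b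
  proof -
    have "\<rho> (Y * U q k) $$ (a, b) = (\<Sum>c\<le>d. if c = q then (if b = k then \<rho> Y $$ (a, q) else 0) else 0)"
      using that by (simp only: mult, intro sum.cong) (auto simp: U_index)
    then show ?thesis using pq by simp
  qed
  have UYU: "\<rho> (U k p * (Y * U q k)) $$ (a, b) = (if a = k \<and> b = k then \<rho> Y $$ (p, q) else 0)"
    if "a \<le> d" "b \<le> d" for k a b
  proof -
    have "\<rho> (U k p * (Y * U q k)) $$ (a, b)
        = (\<Sum>c\<le>d. if c = p then (if a = k \<and> b = k then \<rho> Y $$ (p, q) else 0) else 0)"
      using that by (simp only: mult[of a b "U k p"], intro sum.cong) (auto simp: U_index YU)
    then show ?thesis using pq by simp
  qed
  have "U k p * (Y * U q k) = sA (\<rho> Y $$ (p, q)) (U k k)" for k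
  proof (rule alg.rho_inject, rule eq_matI)
    fix a b assume "a < dim_row (\<rho> (sA (\<rho> Y $$ (p, q)) (U k k)))"
      "b < dim_col (\<rho> (sA (\<rho> Y $$ (p, q)) (U k k)))"
    then show "\<rho> (U k p * (Y * U q k)) $$ (a, b) = \<rho> (sA (\<rho> Y $$ (p, q)) (U k k)) $$ (a, b)"
      by (simp add: UYU U_index alg.iso_scale less_Suc_eq_le)
  qed simp_all
  moreover have "act (U k p * (Y * U q k)) v = 0" for k v
    by (simp add: mod.act_mult Y0 act_zero_right)
  ultimately have "sV (\<rho> Y $$ (p, q)) (act (U k k) v) = 0" for k v
    by (metis act_scale_left)
  then have Ukk: "act (U k k) v = 0" for k v using pq(3) by simp
  have "1 = (\<Sum>k\<le>d. U k k)"
  proof (rule alg.rho_inject, rule eq_matI)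
    have add: "\<rho> (\<Sum>k\<in>S. U k k) $$ (a, b) = (\<Sum>k\<in>S. \<rho> (U k k) $$ (a, b))"
      if ab: "a \<le> d" "b \<le> d" for S :: "nat set" and a b
    proof -
      have "\<rho> 0 $$ (a, b) = 0" using ab by (simp add: alg.rho_zero)
      then show ?thesis
        by (induction S rule: infinite_finite_induct) (use ab in \<open>simp_all add: alg.iso_add\<close>)
    qed
    fix a b assume ab: "a < dim_row (\<rho> (\<Sum>k\<le>d. U k k))" "b < dim_col (\<rho> (\<Sum>k\<le>d. U k k))"
    have "(\<Sum>k\<le>d. \<rho> (U k k) $$ (a, b)) = (\<Sum>k\<le>d. if k = a then (if a = b then 1 else 0) else 0)"
      using ab by (intro sum.cong refl) (auto simp: U_index)
    then show "\<rho> 1 $$ (a, b) = \<rho> (\<Sum>k\<le>d. U k k) $$ (a, b)"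
      using ab by (simp add: add alg.iso_one less_Suc_eq_le)
  qed simp_all
  then have "act (\<Sum>k\<le>d. U k k) v = v" for v using mod.act_one[of v] by simp
  then have "v = 0" for v :: 'v by (simp add: act_sum Ukk)
  then show False using mod.nonzero by blast
qed

text \<open>
  A nonzero vector generates the module, so \<open>w = Y E\<^sub>i v\<close> for some \<open>Y\<close>, and \<open>E\<^sub>i Y E\<^sub>i\<close> is a multiple of
  \<open>E\<^sub>i\<close>.
\<close>

lemma proj_line_act:
  assumes ord: "idempotent_ordering sA d \<rho> X \<theta> E" and i: "i \<le> d" and v: "act (E i) v \<noteq> 0"
  shows "\<exists>c. act (E i) w = sV c (act (E i) v)"
proof -
  obtain Y where Y: "act Y (act (E i) v) = w" using orbit_UNIV[OF v] by blast
  have "act (E i) w = act (E i * Y * E i) v" by (simp add: Y mod.act_mult)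
  then show ?thesis
    using alg.primitive_idempotents(4)[OF ord i, of Y] by (auto simp: act_scale_left)
qed

lemma spectral_decomposition_act:
  assumes ord: "idempotent_ordering sA d \<rho> X \<theta> E"
  shows "spectral_decomposition sV d (\<lambda>i. act (E i))"
proof unfold_locales
  fix v show "(\<Sum>i\<le>d. act (E i) v) = v"
    by (simp add: alg.primitive_idempotents(2)[OF ord] mod.act_one flip: act_sum)
next
  fix i j v assume "i \<le> d" "j \<le> d"
  then show "act (E i) (act (E j) v) = (if i = j then act (E j) v else 0)"
    using alg.primitive_idempotents(1)[OF ord, of i j] mod.act_mult[of "E i" "E j" v]
    by (simp add: act_zero_left split: if_splits)
qed (use proj_line_act[OF ord] in \<open>auto simp: mod.act_add_right act_scale_right\<close>)

text \<open>
  Polynomials evaluated through the eigenvalues agree with polynomials evaluated in the algebra.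
\<close>

lemma ev_act:
  assumes ord: "idempotent_ordering sA d \<rho> X \<theta> E"
  shows "spectral_decomposition.ev sV d (\<lambda>i. act (E i)) \<theta> p v = act (poly_at sA p X) v"
proof -
  interpret spectral_decomposition sV d "\<lambda>i. act (E i)" \<theta>
    by (rule spectral_decomposition_act[OF ord])
  have "act (poly_at sA p X) v = (\<Sum>i\<le>d. act (poly_at sA p X * E i) v)"
    by (simp add: alg.primitive_idempotents(2)[OF ord] flip: act_sum sum_distrib_left)
  also have "\<dots> = ev p v"
    unfolding ev_def
    by (intro sum.cong refl) (simp add: alg.primitive_idempotents(3)[OF ord] act_scale_left)
  finally show ?thesis by simp
qed

lemma poly_at_linear: "poly_at sA [:0, 1:] X = X"
  by (simp add: poly_at_def)

text \<open>
  If \<open>E\<^sup>*\<^sub>i X E\<^sup>*\<^sub>j\<close> is nonzero in the algebra, then by faithfulness it is nonzero on some vector, hence on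
  every vector with nonzero \<open>E\<^sup>*\<^sub>j\<close>-component, because \<open>E\<^sup>*\<^sub>jV\<close> is a line.
\<close>

lemma tridiagonal_operators_act:
  assumes ord: "idempotent_ordering sA d \<rho> X \<theta> E" and ords: "idempotent_ordering sA d \<rho> Xs \<theta>s Es"
    and tri: "\<forall>i\<le>d. \<forall>j\<le>d. (\<bar>int i - int j\<bar> > 1 \<longrightarrow> Es i * X * Es j = 0) \<and>
                   (\<bar>int i - int j\<bar> = 1 \<longrightarrow> Es i * X * Es j \<noteq> 0)"
  shows "tridiagonal_operators sV d (\<lambda>i. act (E i)) \<theta> (\<lambda>i. act (Es i))"
proof (intro tridiagonal_operators.intro tridiagonal_operators_axioms.intro
    spectral_decomposition_act[OF ord] spectral_decomposition_act[OF ords], unfold ev_act[OF ord] poly_at_linear)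
  show "act (Es i) (act X (act (Es j) v)) = 0"
    if "i \<le> d" "j \<le> d" "1 < \<bar>int i - int j\<bar>" for i j v
  proof -
    have "act (Es i * X * Es j) v = 0" using that tri by (simp add: act_zero_left)
    then show ?thesis by (simp add: mod.act_mult)
  qed
  have *: "act (Es i) (act X (act (Es j) v)) \<noteq> 0"
    if ij: "i \<le> d" "j \<le> d" "\<bar>int i - int j\<bar> = 1" and v: "act (Es j) v \<noteq> 0" for i j v
  proof
    assume 0: "act (Es i) (act X (act (Es j) v)) = 0"
    have "Es i * X * Es j \<noteq> 0" using ij tri by blast
    then obtain w where w: "act (Es i * X * Es j) w \<noteq> 0" by (rule faithful)
    obtain c where "act (Es j) w = sV c (act (Es j) v)"
      using proj_line_act[OF ords \<open>j \<le> d\<close> v] by blast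
    then show False using w 0 by (simp add: mod.act_mult act_scale_right)
  qed
  show "act (Es (Suc i)) (act X (act (Es i) v)) \<noteq> 0" if "i < d" "act (Es i) v \<noteq> 0" for i v
    using that by (intro *) auto
  show "act (Es i) (act X (act (Es (Suc i)) v)) \<noteq> 0" if "i < d" "act (Es (Suc i)) v \<noteq> 0" for i v
    using that by (intro *) auto
qed

text \<open>
  The reduction to orthogonality: the sequence \<open>X\<close> is arbitrary.
\<close>

lemma transition_sum:
  assumes "\<And>r. r \<le> d \<Longrightarrow> sV k (act (Y r) v) = (if r = i then z else 0)" "i \<le> d"
  shows "act (sA k (\<Sum>r\<le>d. X r * Y r)) v = act (X i) z"
proof -
  have "act (sA k (\<Sum>r\<le>d. X r * Y r)) v = (\<Sum>r\<le>d. act (X r) (sV k (act (Y r) v)))"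
    by (simp add: act_scale_left act_sum mod.act_mult act_scale_right mod.scale_sum_right)
  also have "\<dots> = (\<Sum>r\<le>d. if r = i then act (X i) z else 0)"
    using assms by (intro sum.cong) (auto simp: act_zero_right)
  finally show ?thesis using assms by simp
qed

lemma adjoint_spectral_form:
  assumes ord: "idempotent_ordering sA d \<rho> X \<theta> E"
    and dag: "antiautomorphism sA dag" "dag X = X"
    and B: "bilinear_form sV B" "\<forall>Y u v. B (act Y u) v = B u (act (dag Y) v)"
  shows "spectral_form sV d (\<lambda>i. act (E i)) B"
proof (intro spectral_form.intro spectral_form_axioms.intro spectral_decomposition_act[OF ord])
  have l: "Vector_Spaces.linear sV (*) (\<lambda>v. B u v)" "Vector_Spaces.linear sV (*) (\<lambda>u. B u v)" for u v
    using B(1) by (auto simp: bilinear_form_def)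
  show "B (u + v) w = B u w + B v w" "B u (v + w) = B u v + B u w"
    "B (sV c u) v = c * B u v" "B u (sV c v) = c * B u v" for u v w c
    using l[of u] l[of v] l[of w] by (auto simp: Vector_Spaces.linear_iff)
  show "B (act (E i) u) v = B u (act (E i) v)" if "i \<le> d" for i u v
  proof -
    obtain p where "E i = poly_at sA p X"
      using alg.primitive_idempotent_poly_at[OF ord \<open>i \<le> d\<close>] by blast
    then have "dag (E i) = E i" using alg.antiautomorphism_poly_at[OF dag] by simp
    then show ?thesis using B(2) by simp
  qed
qed

text \<open>
  The left radical of the form is a submodule.
\<close>

lemma adjoint_form_nondegenerate:
  assumes B: "bilinear_form sV B" "\<forall>Y u v. B (act Y u) v = B u (act (dag Y) v)"
    and nz: "\<exists>u v. B u v \<noteq> 0" and u: "\<And>v. B u v = 0"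
  shows "u = 0"
proof -
  have l: "Vector_Spaces.linear sV (*) (\<lambda>u. B u v)" for v
    using B(1) by (auto simp: bilinear_form_def)
  have add: "B (x + y) v = B x v + B y v" for x y v
    using l[of v] by (auto simp: Vector_Spaces.linear_iff)
  have diff: "B (x - y) v = B x v - B y v" for x y v
    using add[of "x - y" y v] by simp
  have "{u. \<forall>v. B u v = 0} = {0} \<or> {u. \<forall>v. B u v = 0} = UNIV"
    by (rule mod.irreducible) (use diff[of 0 0] in \<open>auto simp: diff B(2)\<close>)
  then show ?thesis using nz u by auto
qed

end

section \<open>The transition formulas\<close>

theorem theorem17p1:
  fixes sA :: "'k::field \<Rightarrow> 'a::ring_1 \<Rightarrow> 'a" (infixr "*\<^sub>A" 75)
    and sV :: "'k \<Rightarrow> 'v::ab_group_add \<Rightarrow> 'v"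
    and act :: "'a \<Rightarrow> 'v \<Rightarrow> 'v" (infixr "\<cdot>" 60)
    and d :: nat
    and \<rho> :: "'a \<Rightarrow> 'k mat"
    and A As :: 'a and E Es :: "nat \<Rightarrow> 'a"
    and \<theta> \<theta>s \<phi>1 \<phi>2 :: "nat \<Rightarrow> 'k"
    and dag :: "'a \<Rightarrow> 'a"
    and B :: "'v \<Rightarrow> 'v \<Rightarrow> 'k" ("\<langle>_, _\<rangle>")
    and \<xi>0 \<xi>d \<xi>s0 \<xi>sd :: 'v
  assumes "full_matrix_algebra sA d \<rho>"
    and "irreducible_left_module sA sV act"
    and "leonard_system sA d \<rho> A E As Es"
    and "parameter_array sA d \<rho> A E As Es \<theta> \<theta>s \<phi>1 \<phi>2"
    and "antiautomorphism sA dag" and "dag A = A" and "dag As = As"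
    and "bilinear_form sV B" and "\<exists>u v. \<langle>u, v\<rangle> \<noteq> 0"
    and "\<forall>X u v. \<langle>X \<cdot> u, v\<rangle> = \<langle>u, dag X \<cdot> v\<rangle>"
    and "\<xi>0 \<in> range (act (E 0))" and "\<xi>0 \<noteq> 0"
    and "\<xi>d \<in> range (act (E d))" and "\<xi>d \<noteq> 0"
    and "\<xi>s0 \<in> range (act (Es 0))" and "\<xi>s0 \<noteq> 0"
    and "\<xi>sd \<in> range (act (Es d))" and "\<xi>sd \<noteq> 0"
  shows
    "(\<forall>X \<in> {E, \<lambda>i. E (d - i),
        \<lambda>i. poly_at sA (tau_poly \<theta> i) A, \<lambda>i. poly_at sA (tau_poly \<theta> (d - i)) A,
        \<lambda>i. poly_at sA (eta_poly d \<theta> i) A, \<lambda>i. poly_at sA (eta_poly d \<theta> (d - i)) A}.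
      \<forall>i\<le>d.
        ((poly (eta_poly d \<theta>s d) (\<theta>s 0) / (\<Prod>h=1..d. \<phi>1 h) * (\<langle>\<xi>d, \<xi>s0\<rangle> / \<langle>\<xi>d, \<xi>sd\<rangle>)) *\<^sub>A
            (\<Sum>r\<le>d. X r * Es 0 * poly_at sA (tau_poly \<theta> (d - r)) A))
            \<cdot> poly_at sA (eta_poly d \<theta> i) A \<cdot> \<xi>sd = X i \<cdot> \<xi>s0 \<and>
        ((1 / alg_trace \<rho> (E d * Es d)) *\<^sub>A
            (\<Sum>r\<le>d. (1 / (\<Prod>h<r. \<phi>1 (d - h))) *\<^sub>A
              (X r * Es d * E d * poly_at sA (eta_poly d \<theta>s r) As)))
            \<cdot> poly_at sA (eta_poly d \<theta> i) A \<cdot> \<xi>sd = X i \<cdot> \<xi>sd \<and>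
        ((poly (eta_poly d \<theta>s d) (\<theta>s 0) / (\<Prod>h=1..d. \<phi>1 h) * (\<langle>\<xi>d, \<xi>s0\<rangle> / \<langle>\<xi>d, \<xi>sd\<rangle>)) *\<^sub>A
            (\<Sum>r\<le>d. X (d - r) * Es 0 * poly_at sA (tau_poly \<theta> (d - r)) A))
            \<cdot> poly_at sA (eta_poly d \<theta> (d - i)) A \<cdot> \<xi>sd = X i \<cdot> \<xi>s0 \<and>
        ((1 / alg_trace \<rho> (E d * Es d)) *\<^sub>A
            (\<Sum>r\<le>d. (1 / (\<Prod>h<r. \<phi>1 (d - h))) *\<^sub>A
              (X (d - r) * Es d * E d * poly_at sA (eta_poly d \<theta>s r) As)))
            \<cdot> poly_at sA (eta_poly d \<theta> (d - i)) A \<cdot> \<xi>sd = X i \<cdot> \<xi>sd) \<and>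
     (\<forall>X \<in> {Es, \<lambda>i. Es (d - i),
        \<lambda>i. poly_at sA (tau_poly \<theta>s i) As, \<lambda>i. poly_at sA (tau_poly \<theta>s (d - i)) As,
        \<lambda>i. poly_at sA (eta_poly d \<theta>s i) As, \<lambda>i. poly_at sA (eta_poly d \<theta>s (d - i)) As}.
      \<forall>i\<le>d.
        ((poly (eta_poly d \<theta>s d) (\<theta>s 0) / (\<Prod>h=1..d. \<phi>2 h) * (\<langle>\<xi>0, \<xi>0\<rangle> / \<langle>\<xi>0, \<xi>sd\<rangle>)) *\<^sub>A
            (\<Sum>r\<le>d. X r * E 0 * Es 0 * poly_at sA (tau_poly \<theta> (d - r)) A))
            \<cdot> poly_at sA (eta_poly d \<theta> i) A \<cdot> \<xi>sd = X i \<cdot> \<xi>0 \<and>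
        ((\<langle>\<xi>d, \<xi>d\<rangle> / \<langle>\<xi>d, \<xi>sd\<rangle>) *\<^sub>A
            (\<Sum>r\<le>d. (1 / (\<Prod>h<r. \<phi>1 (d - h))) *\<^sub>A
              (X r * E d * poly_at sA (eta_poly d \<theta>s r) As)))
            \<cdot> poly_at sA (eta_poly d \<theta> i) A \<cdot> \<xi>sd = X i \<cdot> \<xi>d \<and>
        ((poly (eta_poly d \<theta>s d) (\<theta>s 0) / (\<Prod>h=1..d. \<phi>2 h) * (\<langle>\<xi>0, \<xi>0\<rangle> / \<langle>\<xi>0, \<xi>sd\<rangle>)) *\<^sub>A
            (\<Sum>r\<le>d. X (d - r) * E 0 * Es 0 * poly_at sA (tau_poly \<theta> (d - r)) A))
            \<cdot> poly_at sA (eta_poly d \<theta> (d - i)) A \<cdot> \<xi>sd = X i \<cdot> \<xi>0 \<and>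
        ((\<langle>\<xi>d, \<xi>d\<rangle> / \<langle>\<xi>d, \<xi>sd\<rangle>) *\<^sub>A
            (\<Sum>r\<le>d. (1 / (\<Prod>h<r. \<phi>1 (d - h))) *\<^sub>A
              (X (d - r) * E d * poly_at sA (eta_poly d \<theta>s r) As)))
            \<cdot> poly_at sA (eta_poly d \<theta> (d - i)) A \<cdot> \<xi>sd = X i \<cdot> \<xi>d)"
proof -
  interpret M: matrix_algebra_module sA d \<rho> sV act
    by (intro matrix_algebra_module.intro assms(1,2))
  have ord: "idempotent_ordering sA d \<rho> A \<theta> E" and ords: "idempotent_ordering sA d \<rho> As \<theta>s Es"
    and \<phi>1: "\<And>i. 1 \<le> i \<Longrightarrow> i \<le> d \<Longrightarrow> \<phi>1 i = (\<theta>s 0 - \<theta>s i) *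
       (alg_trace \<rho> (poly_at sA (tau_poly \<theta> i) A * Es 0) /
        alg_trace \<rho> (poly_at sA (tau_poly \<theta> (i - 1)) A * Es 0))"
    and \<phi>2: "\<And>i. 1 \<le> i \<Longrightarrow> i \<le> d \<Longrightarrow> \<phi>2 i = (\<theta>s 0 - \<theta>s i) *
       (alg_trace \<rho> (poly_at sA (eta_poly d \<theta> i) A * Es 0) /
        alg_trace \<rho> (poly_at sA (eta_poly d \<theta> (i - 1)) A * Es 0))"
    using assms(4) by (auto simp: parameter_array_def)
  have tri: "\<forall>i\<le>d. \<forall>j\<le>d. (\<bar>int i - int j\<bar> > 1 \<longrightarrow> E i * As * E j = 0) \<and>
                   (\<bar>int i - int j\<bar> = 1 \<longrightarrow> E i * As * E j \<noteq> 0)"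
    and tris: "\<forall>i\<le>d. \<forall>j\<le>d. (\<bar>int i - int j\<bar> > 1 \<longrightarrow> Es i * A * Es j = 0) \<and>
                   (\<bar>int i - int j\<bar> = 1 \<longrightarrow> Es i * A * Es j \<noteq> 0)"
    using assms(3) by (auto simp: leonard_system_def)
  interpret L: leonard_form sV d "\<lambda>i. act (E i)" \<theta> "\<lambda>i. act (Es i)" \<theta>s B
  proof (intro leonard_form.intro leonard_operators.intro leonard_form_axioms.intro)
    show "tridiagonal_operators sV d (\<lambda>i. act (E i)) \<theta> (\<lambda>i. act (Es i))"
      by (rule M.tridiagonal_operators_act[OF ord ords tris])
    show "tridiagonal_operators sV d (\<lambda>i. act (Es i)) \<theta>s (\<lambda>i. act (E i))"
      by (rule M.tridiagonal_operators_act[OF ords ord tri])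
    show "spectral_form sV d (\<lambda>i. act (E i)) B"
      by (rule M.adjoint_spectral_form[OF ord assms(5,6,8,10)])
    show "spectral_form sV d (\<lambda>i. act (Es i)) B"
      by (rule M.adjoint_spectral_form[OF ords assms(5,7,8,10)])
    show "u = 0" if "\<And>v. B u v = 0" for u
      by (rule M.adjoint_form_nondegenerate[OF assms(8,10,9) that])
  qed
  note ev = M.ev_act[OF ord] and evs = M.ev_act[OF ords]

  have fixed: "act (E i) v = v" if "v \<in> range (act (E i))" "i \<le> d" for i v
    using that L.fst.proj_proj[of i i] by auto
  have fixeds: "act (Es i) v = v" if "v \<in> range (act (Es i))" "i \<le> d" for i v
    using that L.snd.proj_proj[of i i] by auto
  have \<xi>0: "act (E 0) \<xi>0 = \<xi>0" "\<xi>0 \<noteq> 0" and \<xi>d: "act (E d) \<xi>d = \<xi>d" "\<xi>d \<noteq> 0"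
    and \<xi>s0: "act (Es 0) \<xi>s0 = \<xi>s0" "\<xi>s0 \<noteq> 0" and \<xi>sd: "act (Es d) \<xi>sd = \<xi>sd" "\<xi>sd \<noteq> 0"
    using fixed[OF assms(11)] fixed[OF assms(13)] fixeds[OF assms(15)] fixeds[OF assms(17)]
      assms(12,14,16,18) by simp_all

  define T where "T i = alg_trace \<rho> (poly_at sA (tau_poly \<theta> i) A * Es 0)" for i
  define T' where "T' i = alg_trace \<rho> (poly_at sA (eta_poly d \<theta> i) A * Es 0)" for i
  have trace: "act (Es 0) (act Y \<xi>s0) = sV (alg_trace \<rho> (Y * Es 0)) \<xi>s0" for Y
  proof -
    have "act (Es 0) (act Y \<xi>s0) = act (Es 0 * Y * Es 0) \<xi>s0"
      by (simp add: M.mod.act_mult \<xi>s0)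
    then show ?thesis
      using M.alg.primitive_idempotents(4)[OF ords, of 0 Y] by (simp add: M.act_scale_left \<xi>s0)
  qed
  note sp = L.split_parameters[OF \<xi>s0, of T \<phi>1, unfolded ev evs T_def, OF trace \<phi>1, folded T_def]
  note sp' = L.eta_parameters[OF \<xi>s0, of T' \<phi>2, unfolded ev evs T'_def, OF trace \<phi>2, folded T'_def]
  define H where "H = poly (eta_poly d \<theta>s d) (\<theta>s 0)"
  have prod1: "(\<Prod>h=1..d. \<phi>1 h) = H * T d" and prod2: "(\<Prod>h=1..d. \<phi>2 h) = H * T' d"
    and Td: "T d \<noteq> 0" and T'd: "T' d \<noteq> 0"
    using sp(3,4) sp'(1,2) by (simp_all add: H_def)
  have "(\<Prod>h=1..d. \<phi>1 h) \<noteq> 0" using sp(2) by simp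
  then have H: "H \<noteq> 0" using prod1 by auto

  have B0: "B \<xi>0 \<xi>sd \<noteq> 0" "B \<xi>0 \<xi>0 \<noteq> 0" and Bd: "B \<xi>d \<xi>sd \<noteq> 0" "B \<xi>d \<xi>d \<noteq> 0"
    using L.form_dual_nonzero[OF \<xi>sd \<xi>0] L.form_dual_nonzero[OF \<xi>sd \<xi>d]
      L.form_self_nonzero[OF \<xi>0] L.form_self_nonzero[OF \<xi>d] by auto

  define w where "w i = act (poly_at sA (eta_poly d \<theta> i) A) \<xi>sd" for i
  have e_dual: "act (E d) (act (poly_at sA (eta_poly d \<theta>s r) As) (w i))
      = (if r = i then sV (\<Prod>h<r. \<phi>1 (d - h)) (act (E d) \<xi>sd) else 0)"
    if "i \<le> d" "r \<le> d" for i r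
    using L.eta_dual_eta_orthogonal[OF \<xi>sd that, of \<phi>1]
      L.split_parameters_agree[OF \<xi>s0 \<xi>sd, of \<phi>1] sp(1)
    unfolding ev evs w_def by blast
  have \<phi>prod: "(\<Prod>h<r. \<phi>1 (d - h)) \<noteq> 0" if "r \<le> d" for r
    using sp(2) that by auto

  have Tact: "act (Es 0) (act (poly_at sA (tau_poly \<theta> d) A) \<xi>s0) = sV (T d) \<xi>s0"
    and T'act: "act (Es 0) (act (poly_at sA (eta_poly d \<theta> d) A) \<xi>s0) = sV (T' d) \<xi>s0"
    by (simp_all only: trace T_def T'_def)
  note scale_if = simp_thms if_True if_False M.mod.scale_scale M.mod.scale_one M.mod.scale_zero_right
  \<comment> \<open>The four families of operators, each with the scalar in front of its sum: applied to \<open>w i\<close> they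
    give the required vector for \<open>r = i\<close> and \<open>0\<close> otherwise.\<close>
  have key1: "sV (H / (\<Prod>h=1..d. \<phi>1 h) * (B \<xi>d \<xi>s0 / B \<xi>d \<xi>sd))
      (act (Es 0 * poly_at sA (tau_poly \<theta> (d - r)) A) (w i)) = (if r = i then \<xi>s0 else 0)"
    if "i \<le> d" "r \<le> d" for i r
  proof -
    have "B \<xi>d \<xi>s0 \<noteq> 0"
      by (rule L.form_pairing_nonzero[OF \<xi>s0 \<xi>d _ Td]) (simp only: ev Tact)
    then have coef: "H / (\<Prod>h=1..d. \<phi>1 h) * (B \<xi>d \<xi>s0 / B \<xi>d \<xi>sd)
        * (T d * (B \<xi>d \<xi>sd / B \<xi>d \<xi>s0)) = 1"
      unfolding prod1 using H Td Bd by simp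
    show ?thesis
      using L.tau_eta_transition[unfolded ev, OF \<xi>s0 \<xi>sd \<xi>d Tact Td that, folded w_def]
      by (cases "r = i") (simp_all only: M.mod.act_mult coef scale_if)
  qed
  have key3: "sV (H / (\<Prod>h=1..d. \<phi>2 h) * (B \<xi>0 \<xi>0 / B \<xi>0 \<xi>sd))
      (act (E 0 * (Es 0 * poly_at sA (tau_poly \<theta> (d - r)) A)) (w i)) = (if r = i then \<xi>0 else 0)"
    if "i \<le> d" "r \<le> d" for i r
  proof -
    have coef: "H / (\<Prod>h=1..d. \<phi>2 h) * (B \<xi>0 \<xi>0 / B \<xi>0 \<xi>sd)
        * (T' d * (B \<xi>0 \<xi>sd / B \<xi>0 \<xi>0)) = 1"
      unfolding prod2 using H T'd B0 by simp
    show ?thesis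
      using L.proj_tau_eta_transition[unfolded ev, OF \<xi>s0 \<xi>sd \<xi>0 T'act T'd that, folded w_def]
      by (cases "r = i") (simp_all only: M.mod.act_mult coef scale_if)
  qed
  have key4: "sV (B \<xi>d \<xi>d / B \<xi>d \<xi>sd) (act (sA (1 / (\<Prod>h<r. \<phi>1 (d - h)))
      (E d * poly_at sA (eta_poly d \<theta>s r) As)) (w i)) = (if r = i then \<xi>d else 0)"
    if "i \<le> d" "r \<le> d" for i r
    using e_dual[OF that] \<phi>prod[OF that(2)] L.proj_eq_form[OF \<xi>d, of \<xi>sd] Bd
    by (simp add: M.mod.act_mult M.act_scale_left)
  have key2: "sV (1 / alg_trace \<rho> (E d * Es d)) (act (sA (1 / (\<Prod>h<r. \<phi>1 (d - h)))
      (Es d * (E d * poly_at sA (eta_poly d \<theta>s r) As))) (w i)) = (if r = i then \<xi>sd else 0)"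
    if "i \<le> d" "r \<le> d" for i r
  proof -
    have *: "act (Es d) (act (E d) \<xi>sd) = sV (alg_trace \<rho> (E d * Es d)) \<xi>sd"
    proof -
      have "act (Es d) (act (E d) \<xi>sd) = act (Es d * E d * Es d) \<xi>sd"
        by (simp add: M.mod.act_mult \<xi>sd)
      then show ?thesis
        using M.alg.primitive_idempotents(4)[OF ords, of d "E d"] by (simp add: M.act_scale_left \<xi>sd)
    qed
    then have "alg_trace \<rho> (E d * Es d) \<noteq> 0" using L.proj_d_proj_d_nonzero[OF \<xi>sd] by auto
    then show ?thesis
      using e_dual[OF that] \<phi>prod[OF that(2)] *
      by (simp add: M.mod.act_mult M.act_scale_left M.act_scale_right M.act_zero_right)
  qed

  have rev: "act (sA k (\<Sum>r\<le>d. X (d - r) * Y r)) (w (d - i)) = act (X i) z"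
    if "\<And>i r. i \<le> d \<Longrightarrow> r \<le> d \<Longrightarrow> sV k (act (Y r) (w i)) = (if r = i then z else 0)" "i \<le> d"
    for k X Y z i
    using M.transition_sum[of k Y "w (d - i)" "d - i" z "\<lambda>r. X (d - r)"] that by simp
  have fwd: "act (sA k (\<Sum>r\<le>d. X r * Y r)) (w i) = act (X i) z"
    if "\<And>i r. i \<le> d \<Longrightarrow> r \<le> d \<Longrightarrow> sV k (act (Y r) (w i)) = (if r = i then z else 0)" "i \<le> d"
    for k X Y z i
    using M.transition_sum[of k Y "w i" i z X] that by simp
  \<comment> \<open>Moves scalars and brackets so that every summand has the form \<open>X r * Y r\<close>.\<close>
  note simps = mult.assoc M.alg.sA_mult_right[symmetric]
  note transition = fwd[OF key1] fwd[OF key2] fwd[OF key3] fwd[OF key4]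
    rev[OF key1] rev[OF key2] rev[OF key3] rev[OF key4]
  show ?thesis
    unfolding w_def[symmetric] H_def[symmetric] simps
    by (intro conjI ballI allI impI; rule transition[unfolded simps]; assumption)
qed

end
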